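(* There exist absolute constants $c, C > 0$ such that the following holds. Consider the algorithm which, given $\varepsilon > 0$ and access to independent samples from an unknown distribution $\mathcal{D}$ on $\mathbb{R}^n$, draws $T = C n/\varepsilon^2$ samples $x^{(1)},\dots,x^{(T)} \sim \mathcal{D}$, computes $M = \frac{1}{T}\sum_{i=1}^T \|x^{(i)}\|^2$, and outputs "un-truncated" if $M \ge n - c\varepsilon/2$ and "truncated" otherwise. Suppose $\mathcal{D} \in \mathrm{Mix}(\mathcal{P}_{\mathrm{symm}})$. Then: (1) if $\mathcal{D} = N(0,I_n)$, the algorithm outputs "un-truncated" with probability at least $9/10$; (2) if $d_{\mathrm{TV}}(\mathcal{D}, N(0,I_n)) \ge \varepsilon$, the algorithm outputs "truncated" with probability at least $9/10$.
   Context: $\|\cdot\|$ is the Euclidean norm. For a Lebesgue measurable $K \subseteq \mathbb{R}^n$ with Gaussian volume $\mathrm{vol}(K) := \Pr_{x\sim N(0,I_n)}[x\in K] > 0$, $N(0,I_n)|_K$ denotes the standard Gaussian conditioned on $K$, i.e. the distribution with density $\mathrm{vol}(K)^{-1}\varphi_n(x)\mathbf{1}[x\in K]$, where $\varphi_n$ is the standard Gaussian density. A set $K$ is symmetric if $-x\in K$ whenever $x \in K$. $\mathcal{P}_{\mathrm{symm}}$ is the class of all distributions $N(0,I_n)|_K$ with $K\subseteq\mathbb{R}^n$ symmetric convex, and $\mathrm{Mix}(\mathcal{P}_{\mathrm{symm}})$ is the class of all mixtures (convex combinations, possibly of arbitrarily many components, i.e. $N(0,I_n)|_{K}$ with $K$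 drawn from a distribution over symmetric convex sets) of distributions in $\mathcal{P}_{\mathrm{symm}}$. $d_{\mathrm{TV}}$ denotes total variation distance. *)

theory Defs
  imports "HOL-Probability.Probability"
begin

text \<open>
  The constants in the theorem do not depend on the dimension, so the dimension has to be a
  quantified natural number rather than a type.  A point of \<open>\<real>\<^sup>n\<close> is therefore a function in
  \<open>{..<n} \<rightarrow>\<^sub>E UNIV\<close>, and the sigma-algebra is that of the Lebesgue (not only the Borel)
  measurable sets, because a convex set need not be Borel.
\<close>

type_synonym point = "nat \<Rightarrow> real"

definition lebesgue_n :: "nat \<Rightarrow> point measure" where
  "lebesgue_n n = completion (Pi\<^sub>M {..<n} (\<lambda>_. lborel))"

definition gauss_density :: "nat \<Rightarrow> point \<Rightarrow> real" where
  "gauss_density n x = (\<Prod>i<n. std_normal_density (x i))"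

definition std_gaussian :: "nat \<Rightarrow> point measure" where
  "std_gaussian n = density (lebesgue_n n) (\<lambda>x. ennreal (gauss_density n x))"

definition gauss_vol :: "nat \<Rightarrow> point set \<Rightarrow> real" where
  "gauss_vol n K = measure (std_gaussian n) K"

definition truncated_gaussian :: "nat \<Rightarrow> point set \<Rightarrow> point measure" where
  "truncated_gaussian n K =
     density (lebesgue_n n) (\<lambda>x. ennreal (gauss_density n x * indicator K x / gauss_vol n K))"

definition symmetric_n :: "nat \<Rightarrow> point set \<Rightarrow> bool" where
  "symmetric_n n K \<longleftrightarrow> (\<forall>x\<in>K. (\<lambda>i\<in>{..<n}. - x i) \<in> K)"

definition convex_n :: "nat \<Rightarrow> point set \<Rightarrow> bool" where
  "convex_n n K \<longleftrightarrow>
     (\<forall>x\<in>K. \<forall>y\<in>K. \<forall>u\<ge>0. \<forall>v\<ge>0. u + v = 1 \<longrightarrow> (\<lambda>i\<in>{..<n}. u * x i + v * y i) \<in> K)"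

text \<open>
  The symmetric convex sets \<open>K\<close> for which \<open>N(0,I\<^sub>n)\<close> conditioned on \<open>K\<close> is defined.
\<close>

definition symm_convex_sets :: "nat \<Rightarrow> point set set" where
  "symm_convex_sets n =
     {K \<in> sets (lebesgue_n n). symmetric_n n K \<and> convex_n n K \<and> gauss_vol n K > 0}"

text \<open>
  A mixture draws \<open>K\<close> from a probability measure \<open>\<mu>\<close> on symmetric convex sets and then a point
  from the Gaussian truncated to \<open>K\<close>.  There is no canonical sigma-algebra on sets \<open>K\<close>; any one
  is allowed for which \<open>K \<mapsto> N(0,I\<^sub>n)|\<^sub>K\<close> is a probability kernel.  In particular all finite and
  countable convex combinations are included (discrete sigma-algebra).
\<close>

definition Mix_P_symm :: "nat \<Rightarrow> point measure set" where
  "Mix_P_symm n =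
     {\<mu> \<bind> truncated_gaussian n | \<mu>.
        prob_space \<mu> \<and> space \<mu> \<subseteq> symm_convex_sets n \<and>
        truncated_gaussian n \<in> \<mu> \<rightarrow>\<^sub>M prob_algebra (lebesgue_n n)}"

text \<open>Meant for probability measures with the same measurable sets.\<close>

definition tv_dist :: "'a measure \<Rightarrow> 'a measure \<Rightarrow> real" where
  "tv_dist P Q = (SUP A\<in>sets P. \<bar>measure P A - measure Q A\<bar>)"

definition norm_n :: "nat \<Rightarrow> point \<Rightarrow> real" where
  "norm_n n x = sqrt (\<Sum>i<n. (x i)\<^sup>2)"

datatype verdict = Untruncated | Truncated

definition sample_size :: "real \<Rightarrow> nat \<Rightarrow> real \<Rightarrow> nat" where
  "sample_size C n \<epsilon> = nat \<lceil>C * real n / \<epsilon>\<^sup>2\<rceil>"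

definition mean_sq_norm :: "nat \<Rightarrow> nat \<Rightarrow> (nat \<Rightarrow> point) \<Rightarrow> real" where
  "mean_sq_norm n T x = (1 / real T) * (\<Sum>i<T. (norm_n n (x i))\<^sup>2)"

definition test_verdict :: "real \<Rightarrow> real \<Rightarrow> nat \<Rightarrow> real \<Rightarrow> (nat \<Rightarrow> point) \<Rightarrow> verdict" where
  "test_verdict c C n \<epsilon> x =
     (if mean_sq_norm n (sample_size C n \<epsilon>) x \<ge> real n - c * \<epsilon> / 2
      then Untruncated else Truncated)"

definition verdict_prob ::
    "real \<Rightarrow> real \<Rightarrow> nat \<Rightarrow> real \<Rightarrow> point measure \<Rightarrow> verdict \<Rightarrow> real" where
  "verdict_prob c C n \<epsilon> D v =
     \<P>(x in Pi\<^sub>M {..<sample_size C n \<epsilon>} (\<lambda>_. D). test_verdict c C n \<epsilon> x = v)"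

end

theory Submission
  imports Defs
begin

text \<open>
  Write \<open>p\<close> for the Gaussian volume of \<open>K\<close> and \<open>m\<close> for the mean of the squared norm under the Gaussian
  truncated to \<open>K\<close>.  The heart of the matter is the dimension-free bound \<open>n - m \<ge> (1 - p) / 40\<close>.
  The quantity \<open>n - m\<close> is the derivative of \<open>ln (vol (t K))\<close> at \<open>t = 1\<close>, and by the Prekopa-Leindler
  inequality (needed for midpoints only) this function is concave in \<open>t\<close>, so it suffices that some
  dilate of \<open>K\<close> is noticeably larger than a smaller one.  For \<open>p \<ge> 2 / 3\<close> this is Borell's lemma for
  \<open>3 K\<close>.  If \<open>p < 2 / 3\<close> and \<open>K\<close> misses a point of the unit ball, then three disjoint short translates
  of \<open>K\<close> fit into \<open>5 K\<close>.  If \<open>K\<close> contains the unit ball, then Gaussian concentration makes the volume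
  of \<open>t K\<close> jump from below \<open>2 / 3\<close> to above \<open>5 / 6\<close> while \<open>t\<close> grows by a constant.

  Since the total variation distance between the truncated and the full Gaussian is at most \<open>1 - p\<close>,
  a mixture at distance \<open>\<epsilon>\<close> has a mean squared norm of at most \<open>n - \<epsilon> / 40\<close>.  A variance bound of
  order \<open>n\<close> for the components, again from Prekopa-Leindler, and \<open>(n - m)\<^sup>2 \<le> n * (n - m)\<close> for the spread
  of the component means allow Chebyshev's inequality to finish the proof.
\<close>

text \<open>Total variation distance \<open>\<epsilon>\<close> only forces \<open>1 - p\<close> to
  be at least \<open>\<epsilon>\<close> on average over the mixture. The deficit bound must
  therefore be linear in \<open>1 - p\<close>, to survive averaging over the components, and free of
  \<open>n\<close>, to give a fixed threshold. Bodies of moderate volume range from slabs to balls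
  of radius about the square root of \<open>n\<close>. Thin ones have room for disjoint translates,
  fat ones show a sharp jump in volume, and the unit ball separates the two regimes. All of the
  geometry passes through \<open>prekopa_leindler_gaussian\<close>, whose hypothesis has the slack
  factor exp of a quarter of the squared distance. Log-concavity of the dilates and Borell's lemma
  only use that this factor is at least 1; concentration and the variance bound live on it. The
  derivative at \<open>t = 1\<close> is never taken: a grid of mesh \<open>1 / N\<close> and
  Jensen's inequality just below 1 replace it.\<close>

subsection \<open>The midpoint Prekopa-Leindler inequality\<close>

text \<open>Inner regularity is reduced to finite measures by restricting Lebesgue measure to the
  balls \<open>I k\<close> and letting \<open>k\<close> grow.\<close>

lemma emeasure_lborel_inner_compact:
  fixes A :: "'a::euclidean_space set"
  assumes A: "A \<in> sets borel"
  shows "emeasure lborel A = (SUP K \<in> {K. K \<subseteq> A \<and> compact K}. emeasure lborel K)"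
proof (rule antisym)
  define I where "I k = cball (0::'a) (real k)" for k :: nat
  have I[measurable]: "I k \<in> sets borel" for k
    unfolding I_def by measurable
  have "emeasure lborel (A \<inter> I k) \<le> (SUP K \<in> {K. K \<subseteq> A \<and> compact K}. emeasure lborel K)" for k
  proof -
    let ?M = "density lborel (indicator (I k))"
    have M: "emeasure ?M B = emeasure lborel (B \<inter> I k)" if "B \<in> sets borel" for B
      using that by (simp add: emeasure_density nn_integral_set_ennreal[symmetric]
          indicator_inter_arith[symmetric] mult.commute inf_commute)
    have "emeasure ?M (space ?M) \<noteq> \<infinity>"
      using emeasure_compact_finite[of "I k"] M[of UNIV] by (simp add: I_def)
    then have "emeasure ?M A = (SUP K \<in> {K. K \<subseteq> A \<and> compact K}. emeasure ?M K)"
      by (intro inner_regular) (use A in auto)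
    also have "\<dots> \<le> (SUP K \<in> {K. K \<subseteq> A \<and> compact K}. emeasure lborel K)"
    proof (intro SUP_mono)
      fix K assume "K \<in> {K. K \<subseteq> A \<and> compact K}"
      then show "\<exists>L\<in>{K. K \<subseteq> A \<and> compact K}. emeasure ?M K \<le> emeasure lborel L"
        by (intro bexI[of _ K]) (auto simp: M borel_compact intro!: emeasure_mono)
    qed
    finally show ?thesis
      by (simp add: M A)
  qed
  then have "(SUP k. emeasure lborel (A \<inter> I k)) \<le> (SUP K \<in> {K. K \<subseteq> A \<and> compact K}. emeasure lborel K)"
    by (intro SUP_least)
  moreover have "(SUP k. emeasure lborel (A \<inter> I k)) = emeasure lborel (\<Union>k. A \<inter> I k)"
    using A by (intro SUP_emeasure_incseq) (auto simp: incseq_def I_def)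
  moreover have "(\<Union>k. A \<inter> I k) = A"
    by (auto simp: I_def real_arch_simple)
  ultimately show "emeasure lborel A \<le> (SUP K \<in> {K. K \<subseteq> A \<and> compact K}. emeasure lborel K)"
    by simp
qed (intro SUP_least emeasure_mono, use A in auto)

lemma emeasure_lborel_vimage_affine:
  fixes A :: "real set"
  assumes [measurable]: "A \<in> sets borel" and "c \<noteq> 0"
  shows "emeasure lborel A = ennreal \<bar>c\<bar> * emeasure lborel {z. t + c * z \<in> A}"
proof -
  have "emeasure lborel A = (\<integral>\<^sup>+x. indicator A x \<partial>lborel)" by simp
  also have "\<dots> = \<bar>c\<bar> * (\<integral>\<^sup>+x. indicator A (t + c * x) \<partial>lborel)"
    by (rule nn_integral_real_affine) (use assms in auto)
  also have "(\<lambda>x. indicator A (t + c * x)) = (indicator {z. t + c * z \<in> A} :: real \<Rightarrow> ennreal)"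
    by (auto simp: indicator_def)
  also have "(\<integral>\<^sup>+x. indicator {z. t + c * z \<in> A} x \<partial>lborel) = emeasure lborel {z. t + c * z \<in> A}"
    by (subst nn_integral_indicator) auto
  finally show ?thesis .
qed

text \<open>The half-size copies of \<open>A\<close> and \<open>B\<close> pinned at the minimum of \<open>B\<close> and the maximum of
  \<open>A\<close> lie in \<open>C\<close> and meet in one point only.\<close>
lemma brunn_minkowski_real_compact:
  fixes A B C :: "real set"
  assumes A: "compact A" "A \<noteq> {}" and B: "compact B" "B \<noteq> {}" and C[measurable]: "C \<in> sets borel"
    and mid: "\<And>x y. x \<in> A \<Longrightarrow> y \<in> B \<Longrightarrow> (x + y) / 2 \<in> C"
  shows "emeasure lborel A + emeasure lborel B \<le> 2 * emeasure lborel C"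
proof -
  obtain a where a: "a \<in> A" "\<And>x. x \<in> A \<Longrightarrow> x \<le> a"
    using compact_attains_sup[OF A] by auto
  obtain b where b: "b \<in> B" "\<And>y. y \<in> B \<Longrightarrow> b \<le> y"
    using compact_attains_inf[OF B] by auto
  have [measurable]: "A \<in> sets borel" "B \<in> sets borel"
    using A B by (auto intro: borel_compact)
  let ?A = "{z. - b + 2 * z \<in> A}" and ?B = "{z. - a + 2 * z \<in> B}"
  have [measurable]: "?A \<in> sets borel" "?B \<in> sets borel"
    by measurable
  have "emeasure lborel A + emeasure lborel B = 2 * (emeasure lborel ?A + emeasure lborel ?B)"
    using emeasure_lborel_vimage_affine[of A 2 "-b"] emeasure_lborel_vimage_affine[of B 2 "-a"]
    by (simp add: distrib_left)
  also have "emeasure lborel ?A = emeasure lborel (?A - {(a + b) / 2})"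
    by (rule emeasure_Diff_null_set[symmetric]) auto
  also have "emeasure lborel (?A - {(a + b) / 2}) + emeasure lborel ?B
      = emeasure lborel ((?A - {(a + b) / 2}) \<union> ?B)"
  proof (rule plus_emeasure)
    show "(?A - {(a + b) / 2}) \<inter> ?B = {}"
      using a b by (fastforce simp: field_simps)
  qed auto
  also have "\<dots> \<le> emeasure lborel C"
  proof (intro emeasure_mono)
    have "z \<in> C" if "z \<in> ?A" for z using mid[of "- b + 2 * z" b] that b by simp
    moreover have "z \<in> C" if "z \<in> ?B" for z using mid[of a "- a + 2 * z"] that a by simp
    ultimately show "(?A - {(a + b) / 2}) \<union> ?B \<subseteq> C" by auto
  qed simp
  finally show ?thesis
    by (simp add: mult_left_mono)
qed

lemma brunn_minkowski_real:
  fixes A B C :: "real set"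
  assumes A: "A \<in> sets borel" "A \<noteq> {}" and B: "B \<in> sets borel" "B \<noteq> {}" and C: "C \<in> sets borel"
    and mid: "\<And>x y. x \<in> A \<Longrightarrow> y \<in> B \<Longrightarrow> (x + y) / 2 \<in> C"
  shows "emeasure lborel A + emeasure lborel B \<le> 2 * emeasure lborel C"
proof -
  obtain a b where ab: "a \<in> A" "b \<in> B" using A B by auto
  have *: "emeasure lborel K + emeasure lborel L \<le> 2 * emeasure lborel C"
    if "K \<subseteq> A" "compact K" "L \<subseteq> B" "compact L" for K L
  proof -
    \<comment> \<open>\<open>K\<close> or \<open>L\<close> may be empty, where the compact case does
      not apply; adding the fixed points \<open>a\<close> and \<open>b\<close> repairs this without
      leaving \<open>A\<close> and \<open>B\<close>.\<close>
    have "emeasure lborel K + emeasure lborel L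
        \<le> emeasure lborel (insert a K) + emeasure lborel (insert b L)"
      using that by (intro add_mono emeasure_mono) (auto intro!: borel_compact)
    also have "\<dots> \<le> 2 * emeasure lborel C"
      using that ab by (intro brunn_minkowski_real_compact C mid compact_insert) auto
    finally show ?thesis .
  qed
  have "emeasure lborel A + emeasure lborel L \<le> 2 * emeasure lborel C"
    if "L \<subseteq> B" "compact L" for L
    unfolding emeasure_lborel_inner_compact[OF A(1)]
    by (subst ennreal_SUP_add_left[symmetric]) (auto intro!: SUP_least * that)
  then show ?thesis
    unfolding emeasure_lborel_inner_compact[OF B(1)]
    by (subst add.commute, subst ennreal_SUP_add_left[symmetric])
      (auto intro!: SUP_least simp: add.commute)
qed

lemma nn_integral_layer_cake:
  fixes f :: "real \<Rightarrow> real"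
  assumes [measurable]: "f \<in> borel_measurable borel" and f: "\<And>x. 0 \<le> f x"
  shows "(\<integral>\<^sup>+x. ennreal (f x) \<partial>lborel)
    = (\<integral>\<^sup>+s. indicator {0..} s * emeasure lborel {x. s < f x} \<partial>lborel)"
proof -
  have "(\<integral>\<^sup>+x. ennreal (f x) \<partial>lborel)
      = (\<integral>\<^sup>+x. (\<integral>\<^sup>+s. indicator {0..} s * indicator {x. s < f x} x \<partial>lborel) \<partial>lborel)"
  proof (intro nn_integral_cong)
    fix x
    have "ennreal (f x) = emeasure lborel {0..<f x}" using f[of x] by simp
    also have "\<dots> = (\<integral>\<^sup>+s. indicator {0..<f x} s \<partial>lborel)" by simp
    also have "\<dots> = (\<integral>\<^sup>+s. indicator {0..} s * indicator {x. s < f x} x \<partial>lborel)"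
      by (intro nn_integral_cong) (auto simp: indicator_def)
    finally show "ennreal (f x) = (\<integral>\<^sup>+s. indicator {0..} s * indicator {x. s < f x} x \<partial>lborel)" .
  qed
  also have "\<dots> = (\<integral>\<^sup>+s. (\<integral>\<^sup>+x. indicator {0..} s * indicator {x. s < f x} x \<partial>lborel) \<partial>lborel)"
    by (rule lborel_pair.Fubini') measurable
  also have "\<dots> = (\<integral>\<^sup>+s. indicator {0..} s * emeasure lborel {x. s < f x} \<partial>lborel)"
    by (intro nn_integral_cong) (simp add: nn_integral_cmult)
  finally show ?thesis .
qed

lemma ennreal_four_mult_le_power2_sum: "4 * (x * y) \<le> (x + y)\<^sup>2" for x y :: ennreal
proof (cases "x = \<top> \<or> y = \<top>")
  case False
  then obtain a b where ab: "x = ennreal a" "y = ennreal b" "a \<ge> 0" "b \<ge> 0"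
    by (metis ennreal_cases)
  have "4 * (a * b) \<le> (a + b)\<^sup>2" using sum_squares_ge_zero[of "a-b" 0] 
    by (simp add: power2_eq_square algebra_simps)
  then show ?thesis
    using ab by (simp add: ennreal_mult''[symmetric] ennreal_plus[symmetric] ennreal_power
        ennreal_numeral[symmetric] del: ennreal_plus ennreal_numeral)
qed (auto simp: power2_eq_square ennreal_mult_top ennreal_top_mult)

text \<open>With both suprema equal to 1, the level sets of \<open>f\<close> and \<open>g\<close>
  are nonempty for exactly the same levels \<open>s < 1\<close>, so Brunn-Minkowski applies at each
  of them. Integrating over the levels gives the additive inequality, and AM-GM turns it into the
  product form.\<close>

lemma prekopa_leindler_real_normalised:
  fixes f g h :: "real \<Rightarrow> real"
  assumes [measurable]: "f \<in> borel_measurable borel" "g \<in> borel_measurable borel"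
      "h \<in> borel_measurable borel"
    and nonneg: "\<And>x. 0 \<le> f x" "\<And>x. 0 \<le> g x" "\<And>x. 0 \<le> h x"
    and sup: "(SUP x. f x) = 1" "(SUP x. g x) = 1" "bdd_above (range f)" "bdd_above (range g)"
    and mid: "\<And>x y. f x * g y \<le> (h ((x + y) / 2))\<^sup>2"
  shows "(\<integral>\<^sup>+x. f x \<partial>lborel) * (\<integral>\<^sup>+x. g x \<partial>lborel) \<le> (\<integral>\<^sup>+x. h x \<partial>lborel)\<^sup>2"
proof -
  have le1: "f x \<le> 1" "g x \<le> 1" for x
    using cSUP_upper[of x UNIV f] cSUP_upper[of x UNIV g] sup by auto
  have level: "emeasure lborel {x. s < f x} + emeasure lborel {x. s < g x}
      \<le> 2 * emeasure lborel {x. s < h x}" if "s \<ge> 0" for s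
  proof (cases "s < 1")
    case True
    show ?thesis
    proof (rule brunn_minkowski_real)
      show "{x. s < f x} \<noteq> {}" "{x. s < g x} \<noteq> {}"
        using True less_cSUP_iff[of UNIV f s] less_cSUP_iff[of UNIV g s] sup by auto
      fix x y assume xy: "x \<in> {x. s < f x}" "y \<in> {x. s < g x}"
      then have "s\<^sup>2 < f x * g y"
        using \<open>s \<ge> 0\<close> unfolding power2_eq_square by (intro mult_strict_mono') auto
      also note mid[of x y]
      finally show "(x + y) / 2 \<in> {x. s < h x}"
        using nonneg(3) by (auto dest: power2_less_imp_less)
    qed measurable
  next
    case False
    then have "{x. s < f x} = {}" "{x. s < g x} = {}"
      using le1 by (auto simp: not_less intro: order.trans)
    then show ?thesis by simp
  qed
  have [measurable]: "(\<lambda>s. emeasure lborel {x. s < f x}) \<in> borel_measurable borel"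
      "(\<lambda>s. emeasure lborel {x. s < g x}) \<in> borel_measurable borel"
      "(\<lambda>s. emeasure lborel {x. s < h x}) \<in> borel_measurable borel"
    by measurable
  have "(\<integral>\<^sup>+x. f x \<partial>lborel) + (\<integral>\<^sup>+x. g x \<partial>lborel)
      = (\<integral>\<^sup>+s. indicator {0..} s * (emeasure lborel {x. s < f x} + emeasure lborel {x. s < g x}) \<partial>lborel)"
    by (simp add: nn_integral_layer_cake nonneg distrib_left nn_integral_add)
  also have "\<dots> \<le> (\<integral>\<^sup>+s. 2 * (indicator {0..} s * emeasure lborel {x. s < h x}) \<partial>lborel)"
    by (intro nn_integral_mono) (use level in \<open>auto simp: indicator_def\<close>)
  also have "\<dots> = 2 * (\<integral>\<^sup>+x. h x \<partial>lborel)"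
    by (simp add: nn_integral_cmult nn_integral_layer_cake nonneg)
  finally have le: "(\<integral>\<^sup>+x. f x \<partial>lborel) + (\<integral>\<^sup>+x. g x \<partial>lborel) \<le> 2 * (\<integral>\<^sup>+x. h x \<partial>lborel)" .
  have "4 * ((\<integral>\<^sup>+x. f x \<partial>lborel) * (\<integral>\<^sup>+x. g x \<partial>lborel))
      \<le> ((\<integral>\<^sup>+x. f x \<partial>lborel) + (\<integral>\<^sup>+x. g x \<partial>lborel))\<^sup>2"
    by (rule ennreal_four_mult_le_power2_sum)
  also have "\<dots> \<le> (2 * (\<integral>\<^sup>+x. h x \<partial>lborel))\<^sup>2"
    by (intro power_mono le) simp
  also have "\<dots> = 4 * (\<integral>\<^sup>+x. h x \<partial>lborel)\<^sup>2"
    by (simp add: power_mult_distrib)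
  finally show ?thesis
    by (subst (asm) ennreal_mult_le_mult_iff) auto
qed

text \<open>The claim is homogeneous: dividing \<open>f\<close>, \<open>g\<close>, \<open>h\<close>
  by \<open>a\<close>, \<open>b\<close>, \<open>sqrt (a * b)\<close> preserves the hypothesis. If a
  supremum is 0, so is the left-hand side.\<close>

lemma prekopa_leindler_real_bounded:
  fixes f g h :: "real \<Rightarrow> real"
  assumes [measurable]: "f \<in> borel_measurable borel" "g \<in> borel_measurable borel"
      "h \<in> borel_measurable borel"
    and nonneg: "\<And>x. 0 \<le> f x" "\<And>x. 0 \<le> g x" "\<And>x. 0 \<le> h x"
    and bdd: "bdd_above (range f)" "bdd_above (range g)"
    and mid: "\<And>x y. f x * g y \<le> (h ((x + y) / 2))\<^sup>2"
  shows "(\<integral>\<^sup>+x. f x \<partial>lborel) * (\<integral>\<^sup>+x. g x \<partial>lborel) \<le> (\<integral>\<^sup>+x. h x \<partial>lborel)\<^sup>2"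
proof -
  define a b where "a = (SUP x. f x)" and "b = (SUP x. g x)"
  have ub: "f x \<le> a" "g x \<le> b" for x
    unfolding a_def b_def using bdd by (auto intro!: cSUP_upper)
  show ?thesis
  proof (cases "a \<le> 0 \<or> b \<le> 0")
    case True
    then have "(\<forall>x. f x = 0) \<or> (\<forall>x. g x = 0)"
      using ub nonneg by (metis order.trans order_antisym)
    then show ?thesis by auto
  next
    case False
    then have ab: "a > 0" "b > 0" by auto
    have SUP_div: "(SUP x. k x / c) = (SUP x. k x) / c"
      if "bdd_above (range k)" "c > 0" for k :: "real \<Rightarrow> real" and c
      using continuous_at_Sup_mono[of "\<lambda>x. x / c" "range k"] that
      by (auto simp: mono_def divide_right_mono image_image continuous_intros)
    have bdd': "bdd_above (range (\<lambda>x. k x / c))"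
      if "bdd_above (range k)" "c > 0" for k :: "real \<Rightarrow> real" and c
      using that by (auto simp: bdd_above_def intro!: divide_right_mono) (meson divide_right_mono less_imp_le)
    have "(\<integral>\<^sup>+x. f x / a \<partial>lborel) * (\<integral>\<^sup>+x. g x / b \<partial>lborel) \<le> (\<integral>\<^sup>+x. h x / sqrt (a * b) \<partial>lborel)\<^sup>2"
    proof (rule prekopa_leindler_real_normalised)
      show "(SUP x. f x / a) = 1" "(SUP x. g x / b) = 1"
        using ab bdd by (auto simp: SUP_div a_def[symmetric] b_def[symmetric])
      show "f x / a * (g y / b) \<le> (h ((x + y) / 2) / sqrt (a * b))\<^sup>2" for x y
        using mid[of x y] ab by (simp add: power_divide divide_right_mono)
    qed (use nonneg ab bdd in \<open>auto intro!: bdd'\<close>)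
    moreover have scale: "(\<integral>\<^sup>+x. k x \<partial>lborel) = c * (\<integral>\<^sup>+x. k x / c \<partial>lborel)"
      if [measurable]: "k \<in> borel_measurable borel" and "c > 0" for k :: "real \<Rightarrow> real" and c
      using that by (subst nn_integral_cmult[symmetric]) (auto simp: ennreal_mult'[symmetric])
    moreover define X Y Z where "X = (\<integral>\<^sup>+x. f x / a \<partial>lborel)" and "Y = (\<integral>\<^sup>+x. g x / b \<partial>lborel)"
      and "Z = (\<integral>\<^sup>+x. h x / sqrt (a * b) \<partial>lborel)"
    ultimately have XYZ: "X * Y \<le> Z\<^sup>2"
      and scale': "(\<integral>\<^sup>+x. f x \<partial>lborel) = a * X" "(\<integral>\<^sup>+x. g x \<partial>lborel) = b * Y"
        "(\<integral>\<^sup>+x. h x \<partial>lborel) = sqrt (a * b) * Z"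
      using ab by (simp_all only: X_def Y_def Z_def scale[of f a] scale[of g b] scale[of h "sqrt (a * b)"]
          assms(1-3) real_sqrt_gt_zero mult_pos_pos)
    have "a * X * (b * Y) = ennreal a * ennreal b * (X * Y)"
      by (simp add: mult_ac)
    also have "\<dots> \<le> ennreal a * ennreal b * Z\<^sup>2"
      by (intro mult_left_mono XYZ) simp
    also have "ennreal a * ennreal b = (ennreal (sqrt (a * b)))\<^sup>2"
      using ab by (simp add: ennreal_power ennreal_mult'[symmetric])
    finally have "a * X * (b * Y) \<le> (sqrt (a * b) * Z)\<^sup>2"
      by (simp add: power_mult_distrib)
    then show ?thesis
      unfolding scale' .
  qed
qed

text \<open>Cutting all three functions at the same height \<open>k\<close> keeps the hypothesis,
  since the left-hand side is then at most \<open>k * k\<close>. The two suprema on the left run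
  over independent indices, which \<open>cut_mono\<close> brings down to the diagonal. Infinite
  values must be allowed because the induction on the dimension inserts inner integrals
  here.\<close>

lemma prekopa_leindler_real:
  fixes f g h :: "real \<Rightarrow> ennreal"
  assumes [measurable]: "f \<in> borel_measurable borel" "g \<in> borel_measurable borel"
      "h \<in> borel_measurable borel"
    and mid: "\<And>x y. f x * g y \<le> (h ((x + y) / 2))\<^sup>2"
  shows "(\<integral>\<^sup>+x. f x \<partial>lborel) * (\<integral>\<^sup>+x. g x \<partial>lborel) \<le> (\<integral>\<^sup>+x. h x \<partial>lborel)\<^sup>2"
proof -
  define cut :: "nat \<Rightarrow> ennreal \<Rightarrow> ennreal" where "cut k a = min a (of_nat k)" for k a
  have cut_real: "cut k a = ennreal (enn2real (cut k a))" for k a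
  proof -
    have "cut k a < \<top>"
      by (simp add: cut_def min_less_iff_disj of_nat_less_top)
    then show ?thesis by simp
  qed
  have cut_mono: "cut j a \<le> cut k a" if "j \<le> k" for j k a
    using that by (auto simp: cut_def min_def intro: order.trans of_nat_mono)
  have SUP_cut: "(SUP k. cut k a) = a" for a
  proof (rule antisym)
    show "a \<le> (SUP k. cut k a)"
    proof (cases "a = \<top>")
      case True
      then show ?thesis by (simp add: cut_def ennreal_SUP_of_nat_eq_top)
    next
      case False
      then obtain k where "a < of_nat k" using ennreal_Ex_less_of_nat by (auto simp: less_top)
      then show ?thesis by (intro SUP_upper2[of k]) (auto simp: cut_def)
    qed
  qed (auto simp: cut_def intro!: SUP_least)
  have [measurable]: "cut k \<in> borel_measurable borel" for k
    unfolding cut_def by measurable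
  have int_cut: "(\<integral>\<^sup>+x. f x \<partial>lborel) = (SUP k. \<integral>\<^sup>+x. cut k (f x) \<partial>lborel)"
    if [measurable]: "f \<in> borel_measurable borel" for f :: "real \<Rightarrow> ennreal"
    by (subst nn_integral_monotone_convergence_SUP[symmetric])
      (auto simp: incseq_def le_fun_def SUP_cut intro: cut_mono)
  have diag: "(\<integral>\<^sup>+x. cut k (f x) \<partial>lborel) * (\<integral>\<^sup>+x. cut k (g x) \<partial>lborel) \<le> (\<integral>\<^sup>+x. h x \<partial>lborel)\<^sup>2" for k
  proof -
    have "(\<integral>\<^sup>+x. enn2real (cut k (f x)) \<partial>lborel) * (\<integral>\<^sup>+x. enn2real (cut k (g x)) \<partial>lborel)
        \<le> (\<integral>\<^sup>+x. enn2real (cut k (h x)) \<partial>lborel)\<^sup>2"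
    proof (rule prekopa_leindler_real_bounded)
      have "enn2real (cut k a) \<le> real k" for a
        by (intro enn2real_leI) (auto simp: cut_def ennreal_of_nat_eq_real_of_nat)
      then show "bdd_above (range (\<lambda>x. enn2real (cut k (f x))))"
          "bdd_above (range (\<lambda>x. enn2real (cut k (g x))))"
        by (auto intro!: bdd_aboveI)
      fix x y
      have "cut k (f x) * cut k (g y) \<le> (cut k (h ((x + y) / 2)))\<^sup>2"
      proof (cases "h ((x + y) / 2) \<le> of_nat k")
        case True
        have "cut k (f x) * cut k (g y) \<le> f x * g y"
          by (intro mult_mono) (auto simp: cut_def)
        also note mid[of x y]
        finally show ?thesis using True by (simp add: cut_def min_def)
      next
        case False
        have "cut k (f x) * cut k (g y) \<le> of_nat k * of_nat k"
          by (intro mult_mono) (auto simp: cut_def)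
        then show ?thesis using False by (simp add: cut_def min_def power2_eq_square)
      qed
      then show "enn2real (cut k (f x)) * enn2real (cut k (g y)) \<le> (enn2real (cut k (h ((x + y) / 2))))\<^sup>2"
        by (subst (asm) (1 2 3) cut_real)
          (simp add: ennreal_mult'[symmetric] ennreal_power)
    qed auto
    also have "(\<integral>\<^sup>+x. enn2real (cut k (h x)) \<partial>lborel) \<le> (\<integral>\<^sup>+x. h x \<partial>lborel)"
      unfolding cut_real[symmetric] by (intro nn_integral_mono) (simp add: cut_def)
    finally show ?thesis
      unfolding cut_real[symmetric] by (simp add: power_mono)
  qed
  have "(\<integral>\<^sup>+x. cut j (f x) \<partial>lborel) * (\<integral>\<^sup>+x. cut k (g x) \<partial>lborel) \<le> (\<integral>\<^sup>+x. h x \<partial>lborel)\<^sup>2" for j k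
  proof -
    have "(\<integral>\<^sup>+x. cut j (f x) \<partial>lborel) * (\<integral>\<^sup>+x. cut k (g x) \<partial>lborel)
        \<le> (\<integral>\<^sup>+x. cut (max j k) (f x) \<partial>lborel) * (\<integral>\<^sup>+x. cut (max j k) (g x) \<partial>lborel)"
      by (intro mult_mono nn_integral_mono cut_mono) auto
    with diag[of "max j k"] show ?thesis by (meson order.trans)
  qed
  then have "(SUP j. \<integral>\<^sup>+x. cut j (f x) \<partial>lborel) * (\<integral>\<^sup>+x. cut k (g x) \<partial>lborel) \<le> (\<integral>\<^sup>+x. h x \<partial>lborel)\<^sup>2" for k
    by (subst SUP_mult_right_ennreal) (rule SUP_least)
  then have "(SUP j. \<integral>\<^sup>+x. cut j (f x) \<partial>lborel) * (SUP k. \<integral>\<^sup>+x. cut k (g x) \<partial>lborel) \<le> (\<integral>\<^sup>+x. h x \<partial>lborel)\<^sup>2"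
    by (subst SUP_mult_left_ennreal) (rule SUP_least)
  then show ?thesis
    by (simp only: int_cut assms)
qed

section \<open>Prekopa-Leindler in n dimensions, for Borel and then for Lebesgue measurable
  functions\<close>

abbreviation borel_n :: "nat \<Rightarrow> point measure" where
  "borel_n n \<equiv> Pi\<^sub>M {..<n} (\<lambda>_. lborel)"

text \<open>Midpoints of extensional points are extensional: outside \<open>{..<n}\<close> both
  values are the same real \<open>undefined\<close>, and so is their average.\<close>

definition mid_point :: "point \<Rightarrow> point \<Rightarrow> point" where
  "mid_point x y = (\<lambda>i. (x i + y i) / 2)"

interpretation lborel_product: product_sigma_finite "\<lambda>_::nat. lborel :: real measure"
  by unfold_locales

lemma space_borel_n: "space (borel_n n) = {..<n} \<rightarrow>\<^sub>E UNIV"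
  by (simp add: space_PiM)

lemma borel_measurable_nn_integral_fun_upd [measurable]:
  fixes f :: "point \<Rightarrow> ennreal"
  assumes [measurable]: "f \<in> borel_measurable (Pi\<^sub>M (insert n {..<n}) (\<lambda>_. lborel))"
  shows "(\<lambda>s. \<integral>\<^sup>+x. f (x(n := s)) \<partial>borel_n n) \<in> borel_measurable borel"
proof -
  interpret sigma_finite_measure "borel_n n"
    by (rule lborel_product.sigma_finite) simp
  have "(\<lambda>(s, x). f (x(n := s))) \<in> borel_measurable (borel \<Otimes>\<^sub>M borel_n n)"
    using measurable_compose[OF measurable_compose[OF measurable_pair_swap'
        measurable_add_dim[of n "{..<n}" "\<lambda>_. lborel"]] assms]
    by (simp add: split_beta' cong: measurable_cong_sets sets_pair_measure_cong)
  then show ?thesis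
    by (rule borel_measurable_nn_integral)
qed

text \<open>Tensorisation: for fixed last coordinates \<open>s\<close> and \<open>t\<close> the
  induction hypothesis applies to the slices, and its conclusion is the one-dimensional hypothesis
  for the inner integrals as functions of the last coordinate.\<close>

lemma prekopa_leindler_borel_n:
  fixes f g h :: "point \<Rightarrow> ennreal"
  assumes "f \<in> borel_measurable (borel_n n)" "g \<in> borel_measurable (borel_n n)"
      "h \<in> borel_measurable (borel_n n)"
    and "\<And>x y. x \<in> space (borel_n n) \<Longrightarrow> y \<in> space (borel_n n) \<Longrightarrow> f x * g y \<le> (h (mid_point x y))\<^sup>2"
  shows "(\<integral>\<^sup>+x. f x \<partial>borel_n n) * (\<integral>\<^sup>+x. g x \<partial>borel_n n) \<le> (\<integral>\<^sup>+x. h x \<partial>borel_n n)\<^sup>2"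
  using assms
proof (induction n arbitrary: f g h)
  case 0
  have "mid_point (\<lambda>k. undefined) (\<lambda>k. undefined) = (\<lambda>k. undefined)"
    by (simp add: mid_point_def)
  then show ?case
    using "0.prems"(4)[of "\<lambda>k. undefined" "\<lambda>k. undefined"]
    by (simp add: lborel_product.nn_integral_empty space_PiM_empty)
next
  case (Suc n)
  have m[measurable]: "f \<in> borel_measurable (Pi\<^sub>M (insert n {..<n}) (\<lambda>_. lborel))"
      "g \<in> borel_measurable (Pi\<^sub>M (insert n {..<n}) (\<lambda>_. lborel))"
      "h \<in> borel_measurable (Pi\<^sub>M (insert n {..<n}) (\<lambda>_. lborel))"
    using Suc.prems by (simp_all add: lessThan_Suc)
  have split: "(\<integral>\<^sup>+x. k x \<partial>borel_n (Suc n)) = (\<integral>\<^sup>+s. (\<integral>\<^sup>+x. k (x(n := s)) \<partial>borel_n n) \<partial>lborel)"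
    if "k \<in> borel_measurable (Pi\<^sub>M (insert n {..<n}) (\<lambda>_. lborel))" for k :: "point \<Rightarrow> ennreal"
    unfolding lessThan_Suc by (rule lborel_product.product_nn_integral_insert_rev) (use that in auto)
  have "(\<integral>\<^sup>+s. (\<integral>\<^sup>+x. f (x(n := s)) \<partial>borel_n n) \<partial>lborel) * (\<integral>\<^sup>+s. (\<integral>\<^sup>+x. g (x(n := s)) \<partial>borel_n n) \<partial>lborel)
      \<le> (\<integral>\<^sup>+s. (\<integral>\<^sup>+x. h (x(n := s)) \<partial>borel_n n) \<partial>lborel)\<^sup>2"
  proof (rule prekopa_leindler_real)
    fix s t
    show "(\<integral>\<^sup>+x. f (x(n := s)) \<partial>borel_n n) * (\<integral>\<^sup>+x. g (x(n := t)) \<partial>borel_n n)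
        \<le> (\<integral>\<^sup>+x. h (x(n := (s + t) / 2)) \<partial>borel_n n)\<^sup>2"
    proof (rule Suc.IH)
      fix x y assume "x \<in> space (borel_n n)" "y \<in> space (borel_n n)"
      then have "x(n := s) \<in> space (borel_n (Suc n))" "y(n := t) \<in> space (borel_n (Suc n))"
        by (auto simp: space_borel_n PiE_def extensional_def)
      moreover have "mid_point (x(n := s)) (y(n := t)) = (mid_point x y)(n := (s + t) / 2)"
        by (auto simp: mid_point_def)
      ultimately show "f (x(n := s)) * g (y(n := t)) \<le> (h ((mid_point x y)(n := (s + t) / 2)))\<^sup>2"
        using Suc.prems(4) by metis
    qed measurable
  qed measurable
  then show ?case
    by (simp only: split m)
qed

lemma space_lebesgue_n: "space (lebesgue_n n) = {..<n} \<rightarrow>\<^sub>E UNIV"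
  by (simp add: lebesgue_n_def space_borel_n)

text \<open>The Borel versions of \<open>f\<close> and \<open>g\<close> are set to \<open>0\<close>, that of \<open>h\<close> to \<open>\<top>\<close>, on a null set
  off which they agree with the originals; this keeps the pointwise hypothesis.\<close>
lemma prekopa_leindler_lebesgue_n:
  fixes f g h :: "point \<Rightarrow> ennreal"
  assumes f: "f \<in> borel_measurable (lebesgue_n n)" and g: "g \<in> borel_measurable (lebesgue_n n)"
    and h: "h \<in> borel_measurable (lebesgue_n n)"
    and mid: "\<And>x y. x \<in> space (lebesgue_n n) \<Longrightarrow> y \<in> space (lebesgue_n n) \<Longrightarrow>
      f x * g y \<le> (h (mid_point x y))\<^sup>2"
  shows "(\<integral>\<^sup>+x. f x \<partial>lebesgue_n n) * (\<integral>\<^sup>+x. g x \<partial>lebesgue_n n) \<le> (\<integral>\<^sup>+x. h x \<partial>lebesgue_n n)\<^sup>2"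
proof -
  have ex: "\<exists>u N. u \<in> borel_measurable (borel_n n) \<and> N \<in> null_sets (borel_n n) \<and>
      (\<forall>x\<in>space (borel_n n) - N. k x = u x)"
    if "k \<in> borel_measurable (lebesgue_n n)" for k :: "point \<Rightarrow> ennreal"
  proof -
    obtain u where u: "u \<in> borel_measurable (borel_n n)" "AE x in borel_n n. k x = u x"
      using completion_ex_borel_measurable[of k "borel_n n"] \<open>k \<in> _\<close> unfolding lebesgue_n_def by blast
    then obtain N where "N \<in> null_sets (borel_n n)" "{x \<in> space (borel_n n). k x \<noteq> u x} \<subseteq> N"
      by (auto elim!: AE_E intro: that simp: null_sets_def)
    then show ?thesis using u by (intro exI[of _ u] exI[of _ N]) auto
  qed
  obtain f' Nf where f'[measurable]: "f' \<in> borel_measurable (borel_n n)" and Nf: "Nf \<in> null_sets (borel_n n)"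
    "\<And>x. x \<in> space (borel_n n) \<Longrightarrow> x \<notin> Nf \<Longrightarrow> f x = f' x" using ex[OF f] by auto
  obtain g' Ng where g'[measurable]: "g' \<in> borel_measurable (borel_n n)" and Ng: "Ng \<in> null_sets (borel_n n)"
    "\<And>x. x \<in> space (borel_n n) \<Longrightarrow> x \<notin> Ng \<Longrightarrow> g x = g' x" using ex[OF g] by auto
  obtain h' Nh where h'[measurable]: "h' \<in> borel_measurable (borel_n n)" and Nh: "Nh \<in> null_sets (borel_n n)"
    "\<And>x. x \<in> space (borel_n n) \<Longrightarrow> x \<notin> Nh \<Longrightarrow> h x = h' x" using ex[OF h] by auto
  have [measurable]: "Nf \<in> sets (borel_n n)" "Ng \<in> sets (borel_n n)" "Nh \<in> sets (borel_n n)"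
    using Nf Ng Nh by auto
  define F G H where "F x = (if x \<in> Nf then 0 else f' x)" and "G x = (if x \<in> Ng then 0 else g' x)"
    and "H x = (if x \<in> Nh then \<top> else h' x)" for x
  have [measurable]: "F \<in> borel_measurable (borel_n n)" "G \<in> borel_measurable (borel_n n)"
      "H \<in> borel_measurable (borel_n n)"
    unfolding F_def G_def H_def by measurable
  have "AE x in borel_n n. f x = F x" "AE x in borel_n n. g x = G x" "AE x in borel_n n. h x = H x"
    subgoal using AE_not_in[OF Nf(1)] AE_space by eventually_elim (simp add: F_def Nf(2))
    subgoal using AE_not_in[OF Ng(1)] AE_space by eventually_elim (simp add: G_def Ng(2))
    subgoal using AE_not_in[OF Nh(1)] AE_space by eventually_elim (simp add: H_def Nh(2))
    done
  then have eq: "(\<integral>\<^sup>+x. f x \<partial>lebesgue_n n) = (\<integral>\<^sup>+x. F x \<partial>borel_n n)"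
      "(\<integral>\<^sup>+x. g x \<partial>lebesgue_n n) = (\<integral>\<^sup>+x. G x \<partial>borel_n n)"
      "(\<integral>\<^sup>+x. h x \<partial>lebesgue_n n) = (\<integral>\<^sup>+x. H x \<partial>borel_n n)"
    unfolding lebesgue_n_def nn_integral_completion by (auto intro!: nn_integral_cong_AE)
  show ?thesis
    unfolding eq
  proof (rule prekopa_leindler_borel_n)
    fix x y assume xy: "x \<in> space (borel_n n)" "y \<in> space (borel_n n)"
    have m: "mid_point x y \<in> space (borel_n n)"
      using xy by (auto simp: space_borel_n mid_point_def PiE_def extensional_def)
    have "F x \<le> f x" "G y \<le> g y" "h (mid_point x y) \<le> H (mid_point x y)"
      using xy m Nf(2) Ng(2) Nh(2) by (auto simp: F_def G_def H_def)
    then have "F x * G y \<le> f x * g y" "(h (mid_point x y))\<^sup>2 \<le> (H (mid_point x y))\<^sup>2"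
      by (auto intro: mult_mono power_mono)
    with mid[of x y] xy show "F x * G y \<le> (H (mid_point x y))\<^sup>2"
      by (auto simp: lebesgue_n_def intro: order.trans)
  qed auto
qed

subsection \<open>Affine changes of variables\<close>

definition affine_map :: "nat \<Rightarrow> real \<Rightarrow> point \<Rightarrow> point \<Rightarrow> point" where
  "affine_map n t a x = (\<lambda>i\<in>{..<n}. t * x i + a i)"

lemma affine_map_in_space [simp]: "affine_map n t a x \<in> space (lebesgue_n n)"
  by (simp add: affine_map_def space_lebesgue_n)

lemma measurable_affine_map_borel_n [measurable]: "affine_map n t a \<in> borel_n n \<rightarrow>\<^sub>M borel_n n"
  unfolding affine_map_def by measurable

lemma nn_integral_borel_n_affine:
  fixes f :: "point \<Rightarrow> ennreal"
  assumes t: "t \<noteq> 0" and "f \<in> borel_measurable (borel_n n)"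
  shows "(\<integral>\<^sup>+x. f x \<partial>borel_n n) = ennreal (\<bar>t\<bar> ^ n) * (\<integral>\<^sup>+x. f (affine_map n t a x) \<partial>borel_n n)"
  using assms(2)
proof (induction n arbitrary: f)
  case 0
  then show ?case
    by (simp add: lborel_product.nn_integral_empty affine_map_def space_PiM_empty)
next
  case (Suc n)
  have [measurable]: "f \<in> borel_measurable (Pi\<^sub>M (insert n {..<n}) (\<lambda>_. lborel))"
    using Suc.prems by (simp_all add: lessThan_Suc)
  have [measurable]: "(\<lambda>x. f (affine_map (Suc n) t a x)) \<in> borel_measurable (Pi\<^sub>M (insert n {..<n}) (\<lambda>_. lborel))"
    using measurable_compose[OF measurable_affine_map_borel_n[of "Suc n" t a] Suc.prems]
    by (simp add: lessThan_Suc)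
  \<comment> \<open>\<open>?k\<close> transforms the first \<open>n\<close> coordinates and leaves
    the last one alone. It exists to make the partial integral measurable in
    \<open>s\<close>.\<close>
  let ?k = "\<lambda>x. f (\<lambda>i\<in>insert n {..<n}. if i = n then x n else t * x i + a i)"
  have "?k \<in> borel_measurable (Pi\<^sub>M (insert n {..<n}) (\<lambda>_. lborel))"
    by measurable
  from borel_measurable_nn_integral_fun_upd[OF this]
  have "(\<lambda>s. \<integral>\<^sup>+x. ?k (x(n := s)) \<partial>borel_n n) \<in> borel_measurable borel" .
  also have "(\<lambda>s x. ?k (x(n := s))) = (\<lambda>s x. f ((affine_map n t a x)(n := s)))"
    by (intro ext arg_cong[of _ _ f]) (auto simp: affine_map_def restrict_def)
  finally have [measurable]: "(\<lambda>s. \<integral>\<^sup>+x. f ((affine_map n t a x)(n := s)) \<partial>borel_n n) \<in> borel_measurable borel" .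
  have "(\<integral>\<^sup>+x. f x \<partial>borel_n (Suc n)) = (\<integral>\<^sup>+s. (\<integral>\<^sup>+x. f (x(n := s)) \<partial>borel_n n) \<partial>lborel)"
    unfolding lessThan_Suc by (rule lborel_product.product_nn_integral_insert_rev) auto
  also have "\<dots> = (\<integral>\<^sup>+s. ennreal (\<bar>t\<bar> ^ n) * (\<integral>\<^sup>+x. f ((affine_map n t a x)(n := s)) \<partial>borel_n n) \<partial>lborel)"
    by (intro nn_integral_cong Suc.IH) measurable
  also have "\<dots> = ennreal \<bar>t\<bar> * (\<integral>\<^sup>+s. ennreal (\<bar>t\<bar> ^ n) *
      (\<integral>\<^sup>+x. f ((affine_map n t a x)(n := a n + t * s)) \<partial>borel_n n) \<partial>lborel)"
    by (rule nn_integral_real_affine[OF _ t]) measurable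
  also have "\<dots> = ennreal (\<bar>t\<bar> ^ Suc n) *
      (\<integral>\<^sup>+s. (\<integral>\<^sup>+x. f ((affine_map n t a x)(n := a n + t * s)) \<partial>borel_n n) \<partial>lborel)"
    by (subst nn_integral_cmult) (auto simp: mult.assoc[symmetric] ennreal_mult'[symmetric])
  also have "(\<integral>\<^sup>+s. (\<integral>\<^sup>+x. f ((affine_map n t a x)(n := a n + t * s)) \<partial>borel_n n) \<partial>lborel)
      = (\<integral>\<^sup>+s. (\<integral>\<^sup>+x. f (affine_map (Suc n) t a (x(n := s))) \<partial>borel_n n) \<partial>lborel)"
  proof (intro nn_integral_cong)
    fix s x
    have "(affine_map n t a x)(n := a n + t * s) = affine_map (Suc n) t a (x(n := s))"
      by (auto simp: affine_map_def restrict_def)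
    then show "f ((affine_map n t a x)(n := a n + t * s)) = f (affine_map (Suc n) t a (x(n := s)))"
      by simp
  qed
  also have "\<dots> = (\<integral>\<^sup>+x. f (affine_map (Suc n) t a x) \<partial>borel_n (Suc n))"
    unfolding lessThan_Suc
    by (rule lborel_product.product_nn_integral_insert_rev[symmetric]) auto
  finally show ?case .
qed

text \<open>This is what carries affine maps from Borel to Lebesgue measurability: a preimage of a
  completed null set must again be null.\<close>

lemma affine_map_vimage_null_sets:
  assumes t: "t \<noteq> 0" and N: "N \<in> null_sets (borel_n n)"
  shows "AE x in borel_n n. affine_map n t a x \<notin> N"
proof -
  have [measurable]: "N \<in> sets (borel_n n)" using N by auto
  have "ennreal (\<bar>t\<bar> ^ n) * (\<integral>\<^sup>+x. indicator N (affine_map n t a x) \<partial>borel_n n) = (\<integral>\<^sup>+x. indicator N x \<partial>borel_n n)"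
    by (rule nn_integral_borel_n_affine[OF t, symmetric]) simp
  also have "\<dots> = 0" using N by auto
  finally have "ennreal (\<bar>t\<bar> ^ n) * (\<integral>\<^sup>+x. indicator N (affine_map n t a x) \<partial>borel_n n) = 0" .
  moreover have "0 < \<bar>t\<bar> ^ n" using t by simp
  ultimately have "(\<integral>\<^sup>+x. indicator N (affine_map n t a x) \<partial>borel_n n) = 0"
    by (auto simp: ennreal_eq_0_iff)
  then have "AE x in borel_n n. (indicator N (affine_map n t a x) :: ennreal) = 0"
    by (subst (asm) nn_integral_0_iff_AE) auto
  then show ?thesis
    by eventually_elim (auto simp: indicator_def split: if_splits)
qed

lemma complete_measure_lebesgue_n: "complete_measure (lebesgue_n n)"
  unfolding lebesgue_n_def by (rule completion.complete_measure_axioms)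

lemma measurable_affine_map:
  assumes t: "t \<noteq> 0"
  shows "affine_map n t a \<in> lebesgue_n n \<rightarrow>\<^sub>M lebesgue_n n"
proof -
  interpret complete_measure "lebesgue_n n" by (rule complete_measure_lebesgue_n)
  have m: "affine_map n t a \<in> lebesgue_n n \<rightarrow>\<^sub>M borel_n n"
    unfolding lebesgue_n_def by (intro measurable_completion) measurable
  have "N \<in> null_sets (distr (lebesgue_n n) (borel_n n) (affine_map n t a))"
    if N: "N \<in> null_sets (borel_n n)" for N
  proof -
    have "AE x in distr (lebesgue_n n) (borel_n n) (affine_map n t a). x \<notin> N"
      using AE_completion[OF affine_map_vimage_null_sets[OF t N, of a], folded lebesgue_n_def] N
      by (subst AE_distr_iff[OF m]) auto
    then show ?thesis
      using N by (subst Measure_Space.AE_iff_null_sets) auto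
  qed
  then show ?thesis
    using measurable_completion2[OF m] by (auto simp: lebesgue_n_def)
qed

lemma nn_integral_lebesgue_n_affine:
  fixes f :: "point \<Rightarrow> ennreal"
  assumes t: "t \<noteq> 0" and f: "f \<in> borel_measurable (lebesgue_n n)"
  shows "(\<integral>\<^sup>+x. f x \<partial>lebesgue_n n)
    = ennreal (\<bar>t\<bar> ^ n) * (\<integral>\<^sup>+x. f (affine_map n t a x) \<partial>lebesgue_n n)"
proof -
  obtain u where u: "u \<in> borel_measurable (borel_n n)" "AE x in borel_n n. f x = u x"
    using completion_ex_borel_measurable[of f "borel_n n"] f unfolding lebesgue_n_def by blast
  then obtain N where N: "N \<in> null_sets (borel_n n)" "{x \<in> space (borel_n n). f x \<noteq> u x} \<subseteq> N"
    by (auto elim!: AE_E intro: that simp: null_sets_def)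
  have "(\<integral>\<^sup>+x. f x \<partial>lebesgue_n n) = (\<integral>\<^sup>+x. u x \<partial>borel_n n)"
    using u(2) unfolding lebesgue_n_def nn_integral_completion by (rule nn_integral_cong_AE)
  also have "\<dots> = ennreal (\<bar>t\<bar> ^ n) * (\<integral>\<^sup>+x. u (affine_map n t a x) \<partial>borel_n n)"
    by (rule nn_integral_borel_n_affine[OF t u(1)])
  also have "(\<integral>\<^sup>+x. u (affine_map n t a x) \<partial>borel_n n) = (\<integral>\<^sup>+x. f (affine_map n t a x) \<partial>lebesgue_n n)"
    unfolding lebesgue_n_def nn_integral_completion
  proof (rule nn_integral_cong_AE)
    show "AE x in borel_n n. u (affine_map n t a x) = f (affine_map n t a x)"
      using affine_map_vimage_null_sets[OF t N(1), of a]
      by eventually_elim (use N(2) affine_map_in_space in \<open>force simp: lebesgue_n_def\<close>)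
  qed
  finally show ?thesis .
qed

subsection \<open>The standard Gaussian\<close>

definition sq_norm :: "nat \<Rightarrow> point \<Rightarrow> real" where
  "sq_norm n x = (\<Sum>i<n. (x i)\<^sup>2)"

lemma norm_n_power2: "(norm_n n x)\<^sup>2 = sq_norm n x"
  by (simp add: norm_n_def sq_norm_def sum_nonneg)

lemma sq_norm_nonneg [simp]: "0 \<le> sq_norm n x"
  by (simp add: sq_norm_def sum_nonneg)

lemma gauss_density_eq: "gauss_density n x = (1 / sqrt (2 * pi)) ^ n * exp (- sq_norm n x / 2)"
proof -
  have "gauss_density n x = (1 / sqrt (2 * pi)) ^ n * exp (\<Sum>i<n. - (x i)\<^sup>2 / 2)"
    unfolding gauss_density_def std_normal_density_def prod.distrib by (simp add: exp_sum)
  also have "(\<Sum>i<n. - (x i)\<^sup>2 / 2) = - sq_norm n x / 2"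
    by (simp add: sq_norm_def sum_divide_distrib sum_negf)
  finally show ?thesis .
qed

lemma gauss_density_pos: "0 < gauss_density n x"
  by (simp add: gauss_density_eq)

lemma measurable_lebesgue_nI: "f \<in> borel_n n \<rightarrow>\<^sub>M M \<Longrightarrow> f \<in> lebesgue_n n \<rightarrow>\<^sub>M M"
  unfolding lebesgue_n_def by (rule measurable_completion)

lemma measurable_sq_norm_borel_n [measurable]: "sq_norm n \<in> borel_measurable (borel_n n)"
  unfolding sq_norm_def by measurable

lemma measurable_sq_norm [measurable]: "sq_norm n \<in> borel_measurable (lebesgue_n n)"
  by (rule measurable_lebesgue_nI) measurable

lemma measurable_gauss_density_borel_n [measurable]: "gauss_density n \<in> borel_measurable (borel_n n)"
  unfolding gauss_density_eq by measurable

lemma measurable_gauss_density [measurable]: "gauss_density n \<in> borel_measurable (lebesgue_n n)"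
  by (rule measurable_lebesgue_nI) measurable

lemma sets_std_gaussian [simp, measurable_cong]: "sets (std_gaussian n) = sets (lebesgue_n n)"
  by (simp add: std_gaussian_def)

lemma space_std_gaussian [simp]: "space (std_gaussian n) = space (lebesgue_n n)"
  by (simp add: std_gaussian_def)

lemma nn_integral_std_gaussian:
  fixes f :: "point \<Rightarrow> ennreal"
  assumes "f \<in> borel_measurable (lebesgue_n n)"
  shows "(\<integral>\<^sup>+x. f x \<partial>std_gaussian n) = (\<integral>\<^sup>+x. gauss_density n x * f x \<partial>lebesgue_n n)"
  unfolding std_gaussian_def by (rule nn_integral_density) (use assms in auto)

lemma nn_integral_std_gaussian_prod:
  fixes f :: "nat \<Rightarrow> real \<Rightarrow> ennreal"
  assumes [measurable]: "\<And>i. f i \<in> borel_measurable borel"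
  shows "(\<integral>\<^sup>+x. (\<Prod>i<n. f i (x i)) \<partial>std_gaussian n)
    = (\<Prod>i<n. \<integral>\<^sup>+s. std_normal_density s * f i s \<partial>lborel)"
proof -
  have "(\<integral>\<^sup>+x. (\<Prod>i<n. f i (x i)) \<partial>std_gaussian n)
      = (\<integral>\<^sup>+x. gauss_density n x * (\<Prod>i<n. f i (x i)) \<partial>borel_n n)"
    by (subst nn_integral_std_gaussian)
      (auto simp: lebesgue_n_def nn_integral_completion intro!: measurable_completion)
  also have "\<dots> = (\<integral>\<^sup>+x. (\<Prod>i<n. std_normal_density (x i) * f i (x i)) \<partial>borel_n n)"
    by (simp add: gauss_density_def prod.distrib prod_ennreal)
  also have "\<dots> = (\<Prod>i<n. \<integral>\<^sup>+s. std_normal_density s * f i s \<partial>lborel)"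
    by (rule lborel_product.product_nn_integral_prod) auto
  finally show ?thesis .
qed

lemma nn_integral_std_normal_density: "(\<integral>\<^sup>+s. std_normal_density s \<partial>lborel) = 1"
  by (subst nn_integral_eq_integral) auto

lemma nn_integral_std_normal_density_power2:
  "(\<integral>\<^sup>+s. std_normal_density s * ennreal (s\<^sup>2) \<partial>lborel) = 1"
proof -
  have "(\<integral>\<^sup>+s. ennreal (std_normal_density s * s\<^sup>2) \<partial>lborel) = ennreal 1"
    using normal_moment_even[of 1 0 1]
    by (subst nn_integral_eq_integral)
      (auto simp: has_bochner_integral_iff fact_numeral)
  then show ?thesis by (simp add: ennreal_mult')
qed

lemma prob_space_std_gaussian: "prob_space (std_gaussian n)"
proof (rule prob_spaceI)
  have "emeasure (std_gaussian n) (space (std_gaussian n)) = (\<integral>\<^sup>+x. (\<Prod>i<n. 1) \<partial>std_gaussian n)"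
    by simp
  also have "\<dots> = 1"
    by (subst nn_integral_std_gaussian_prod) (auto simp: nn_integral_std_normal_density)
  finally show "emeasure (std_gaussian n) (space (std_gaussian n)) = 1" .
qed

lemma nn_integral_sq_norm: "(\<integral>\<^sup>+x. sq_norm n x \<partial>std_gaussian n) = of_nat n"
proof -
  have coord: "(\<integral>\<^sup>+x. ennreal ((x j)\<^sup>2) \<partial>std_gaussian n) = 1" if j: "j < n" for j
  proof -
    have "(\<integral>\<^sup>+x. ennreal ((x j)\<^sup>2) \<partial>std_gaussian n)
        = (\<integral>\<^sup>+x. (\<Prod>i<n. if i = j then ennreal ((x i)\<^sup>2) else 1) \<partial>std_gaussian n)"
      using j by (intro nn_integral_cong) (simp add: prod.delta)
    also have "\<dots> = (\<Prod>i<n. \<integral>\<^sup>+s. std_normal_density s * (if i = j then ennreal (s\<^sup>2) else 1) \<partial>lborel)"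
      by (rule nn_integral_std_gaussian_prod) auto
    also have "\<dots> = 1"
    proof (intro prod.neutral ballI)
      fix i
      show "(\<integral>\<^sup>+s. std_normal_density s * (if i = j then ennreal (s\<^sup>2) else 1) \<partial>lborel) = 1"
        by (cases "i = j")
          (simp_all add: nn_integral_std_normal_density nn_integral_std_normal_density_power2)
    qed
    finally show ?thesis .
  qed
  have "(\<integral>\<^sup>+x. sq_norm n x \<partial>std_gaussian n) = (\<integral>\<^sup>+x. (\<Sum>i<n. ennreal ((x i)\<^sup>2)) \<partial>std_gaussian n)"
    by (simp add: sq_norm_def sum_ennreal)
  also have "\<dots> = (\<Sum>i<n. \<integral>\<^sup>+x. ennreal ((x i)\<^sup>2) \<partial>std_gaussian n)"
  proof (rule nn_integral_sum)
    fix i assume "i \<in> {..<n}"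
    then have "(\<lambda>x. ennreal ((x i)\<^sup>2)) \<in> borel_measurable (lebesgue_n n)"
      by (intro measurable_lebesgue_nI) measurable
    then show "(\<lambda>x. ennreal ((x i)\<^sup>2)) \<in> borel_measurable (std_gaussian n)"
      by (simp add: measurable_cong_sets[OF sets_std_gaussian refl])
  qed
  also have "\<dots> = of_nat n" by (simp add: coord)
  finally show ?thesis .
qed

text \<open>By the parallelogram identity, the product of the densities at \<open>x\<close> and
  \<open>y\<close>, times exp of a quarter of the squared distance, is the squared density at the
  midpoint. The Gaussian weight thus pays for the extra factor in the hypothesis.\<close>

lemma prekopa_leindler_gaussian:
  fixes f g h :: "point \<Rightarrow> ennreal"
  assumes [measurable]: "f \<in> borel_measurable (lebesgue_n n)" "g \<in> borel_measurable (lebesgue_n n)"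
      "h \<in> borel_measurable (lebesgue_n n)"
    and mid: "\<And>x y. x \<in> space (lebesgue_n n) \<Longrightarrow> y \<in> space (lebesgue_n n) \<Longrightarrow>
      f x * g y \<le> (h (mid_point x y))\<^sup>2 * exp (sq_norm n (\<lambda>i. x i - y i) / 4)"
  shows "(\<integral>\<^sup>+x. f x \<partial>std_gaussian n) * (\<integral>\<^sup>+x. g x \<partial>std_gaussian n) \<le> (\<integral>\<^sup>+x. h x \<partial>std_gaussian n)\<^sup>2"
proof -
  have "(\<integral>\<^sup>+x. gauss_density n x * f x \<partial>lebesgue_n n) * (\<integral>\<^sup>+x. gauss_density n x * g x \<partial>lebesgue_n n)
      \<le> (\<integral>\<^sup>+x. gauss_density n x * h x \<partial>lebesgue_n n)\<^sup>2"
  proof (rule prekopa_leindler_lebesgue_n)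
    fix x y assume xy: "x \<in> space (lebesgue_n n)" "y \<in> space (lebesgue_n n)"
    have sq: "sq_norm n x / 2 + sq_norm n y / 2 - sq_norm n (\<lambda>i. x i - y i) / 4 = sq_norm n (mid_point x y)"
      unfolding sq_norm_def mid_point_def sum_divide_distrib sum.distrib[symmetric] sum_subtractf[symmetric]
      by (intro sum.cong) (auto simp: power2_eq_square field_simps)
    have "gauss_density n x * gauss_density n y * exp (sq_norm n (\<lambda>i. x i - y i) / 4)
        = ((1 / sqrt (2 * pi)) ^ n)\<^sup>2 * exp (- (sq_norm n x / 2 + sq_norm n y / 2 - sq_norm n (\<lambda>i. x i - y i) / 4))"
      by (simp add: gauss_density_eq power2_eq_square exp_add[symmetric] exp_diff exp_minus field_simps)
    also have "\<dots> = (gauss_density n (mid_point x y))\<^sup>2"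
      unfolding sq by (simp add: gauss_density_eq power_mult_distrib exp_double[symmetric])
    finally have dens: "ennreal (gauss_density n x) * gauss_density n y * exp (sq_norm n (\<lambda>i. x i - y i) / 4)
        = (gauss_density n (mid_point x y))\<^sup>2"
      by (simp add: ennreal_mult'[symmetric] less_imp_le gauss_density_pos)
    have "gauss_density n x * f x * (gauss_density n y * g y)
        = ennreal (gauss_density n x) * gauss_density n y * (f x * g y)"
      by (simp add: mult_ac)
    also have "\<dots> \<le> ennreal (gauss_density n x) * gauss_density n y *
        ((h (mid_point x y))\<^sup>2 * exp (sq_norm n (\<lambda>i. x i - y i) / 4))"
      by (intro mult_left_mono mid xy) simp
    also have "\<dots> = (ennreal (gauss_density n x) * gauss_density n y * exp (sq_norm n (\<lambda>i. x i - y i) / 4))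
        * (h (mid_point x y))\<^sup>2"
      by (simp add: mult_ac)
    also have "\<dots> = (gauss_density n (mid_point x y) * h (mid_point x y))\<^sup>2"
      unfolding dens by (simp add: power_mult_distrib ennreal_power less_imp_le gauss_density_pos)
    finally show "gauss_density n x * f x * (gauss_density n y * g y)
        \<le> (gauss_density n (mid_point x y) * h (mid_point x y))\<^sup>2" .
  qed measurable
  then show ?thesis by (simp add: nn_integral_std_gaussian)
qed

subsection \<open>Dilates and translates of a symmetric convex set\<close>

interpretation std_gaussian: prob_space "std_gaussian n" for n
  by (rule prob_space_std_gaussian)

lemma integrable_sq_norm: "integrable (std_gaussian n) (sq_norm n)"
proof (rule integrableI_bounded)
  show "sq_norm n \<in> borel_measurable (std_gaussian n)"
    by measurable
  have "(\<integral>\<^sup>+x. ennreal (norm (sq_norm n x)) \<partial>std_gaussian n) = of_nat n"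
    using nn_integral_sq_norm[of n] by simp
  then show "(\<integral>\<^sup>+x. ennreal (norm (sq_norm n x)) \<partial>std_gaussian n) < \<infinity>"
    by (simp only: of_nat_less_top infinity_ennreal_def)
qed

lemma integral_sq_norm: "(\<integral>x. sq_norm n x \<partial>std_gaussian n) = real n"
  using nn_integral_eq_integral[OF integrable_sq_norm] nn_integral_sq_norm[of n]
  by (simp add: ennreal_of_nat_eq_real_of_nat)

locale symm_convex_set =
  fixes n :: nat and K :: "point set"
  assumes K_in: "K \<in> symm_convex_sets n"
begin

lemma K_sets [measurable]: "K \<in> sets (lebesgue_n n)"
  and vol_pos: "gauss_vol n K > 0"
  using K_in by (auto simp: symm_convex_sets_def)

lemma K_space: "x \<in> K \<Longrightarrow> x \<in> space (lebesgue_n n)"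
  using sets.sets_into_space[OF K_sets] by auto

text \<open>Membership is phrased for any \<open>z\<close> with the right coordinates, so that users
  can keep their own form of the point instead of a \<open>restrict\<close> term.\<close>

lemma K_convex:
  assumes "x \<in> K" "y \<in> K" "0 \<le> u" "0 \<le> v" "u + v = 1" "z \<in> space (lebesgue_n n)"
    and z: "\<And>i. i < n \<Longrightarrow> z i = u * x i + v * y i"
  shows "z \<in> K"
proof -
  have "z = (\<lambda>i\<in>{..<n}. u * x i + v * y i)"
    using assms(6) z by (intro ext) (auto simp: space_lebesgue_n PiE_def extensional_def)
  then show ?thesis
    using K_in assms(1-5) by (auto simp: symm_convex_sets_def convex_n_def)
qed

text \<open>\<open>c * x\<close> is the convex combination of \<open>x\<close> and
  \<open>- x\<close> with weights \<open>(1 + c) / 2\<close> and \<open>(1 - c) / 2\<close>.\<close>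

lemma K_scale:
  assumes "x \<in> K" "\<bar>c\<bar> \<le> 1" "z \<in> space (lebesgue_n n)" and z: "\<And>i. i < n \<Longrightarrow> z i = c * x i"
  shows "z \<in> K"
proof (rule K_convex[of x "\<lambda>i\<in>{..<n}. - x i" "(1 + c) / 2" "(1 - c) / 2"])
  show "(\<lambda>i\<in>{..<n}. - x i) \<in> K"
    using K_in \<open>x \<in> K\<close> by (auto simp: symm_convex_sets_def symmetric_n_def)
  show "z i = (1 + c) / 2 * x i + (1 - c) / 2 * (\<lambda>i\<in>{..<n}. - x i) i" if "i < n" for i
    using that z by (simp add: field_simps)
qed (use assms in \<open>auto simp: field_simps\<close>)

lemma K_absconvex:
  assumes "x \<in> K" "y \<in> K" "\<bar>u\<bar> + \<bar>v\<bar> \<le> 1" "z \<in> space (lebesgue_n n)"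
    and z: "\<And>i. i < n \<Longrightarrow> z i = u * x i + v * y i"
  shows "z \<in> K"
proof (cases "\<bar>u\<bar> + \<bar>v\<bar> = 0")
  case True
  then have "u = 0" "v = 0" by auto
  then show ?thesis
    using assms(4) z by (intro K_scale[OF \<open>x \<in> K\<close>, of 0]) auto
next
  case False
  \<comment> \<open>The signs and the total weight \<open>s\<close> are absorbed into the two points
    by \<open>K_scale\<close>; the remaining weights are nonnegative and sum to 1.\<close>
  define s where "s = \<bar>u\<bar> + \<bar>v\<bar>"
  have s: "0 < s" "s \<le> 1" using assms False by (auto simp: s_def)
  have sgn: "\<bar>s * sgn w\<bar> \<le> 1" for w using s by (auto simp: abs_mult sgn_if)
  show ?thesis
  proof (rule K_convex)
    show "(\<lambda>i\<in>{..<n}. s * sgn u * x i) \<in> K"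
      by (rule K_scale[OF assms(1) sgn[of u]]) (auto simp: space_lebesgue_n)
    show "(\<lambda>i\<in>{..<n}. s * sgn v * y i) \<in> K"
      by (rule K_scale[OF assms(2) sgn[of v]]) (auto simp: space_lebesgue_n)
    show "\<bar>u\<bar> / s + \<bar>v\<bar> / s = 1" using s by (simp add: add_divide_distrib[symmetric] s_def[symmetric])
    show "z i = \<bar>u\<bar> / s * (\<lambda>i\<in>{..<n}. s * sgn u * x i) i + \<bar>v\<bar> / s * (\<lambda>i\<in>{..<n}. s * sgn v * y i) i" if "i < n" for i
      using that z s by (simp add: mult.assoc[symmetric] abs_mult_sgn)
  qed (use s assms in auto)
qed

text \<open>Dilates and translates are encoded as preimages under the inverse map, so that their
  measurability comes from \<open>measurable_affine_map\<close>.\<close>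

definition dilate :: "real \<Rightarrow> point set" where
  "dilate t = {x \<in> space (lebesgue_n n). affine_map n (1 / t) (\<lambda>_. 0) x \<in> K}"

definition translate :: "point \<Rightarrow> point set" where
  "translate v = {x \<in> space (lebesgue_n n). affine_map n 1 (\<lambda>i. - v i) x \<in> K}"

abbreviation vol_dilate :: "real \<Rightarrow> real" where
  "vol_dilate t \<equiv> measure (std_gaussian n) (dilate t)"

lemma dilate_sets [measurable]:
  assumes "t \<noteq> 0"
  shows "dilate t \<in> sets (lebesgue_n n)"
proof -
  have "dilate t = affine_map n (1 / t) (\<lambda>_. 0) -` K \<inter> space (lebesgue_n n)"
    by (auto simp: dilate_def)
  then show ?thesis
    using measurable_sets[OF measurable_affine_map K_sets, of "1 / t"] assms by simp
qed

lemma translate_sets [measurable]: "translate v \<in> sets (lebesgue_n n)"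
proof -
  have "translate v = affine_map n 1 (\<lambda>i. - v i) -` K \<inter> space (lebesgue_n n)"
    by (auto simp: translate_def)
  then show ?thesis
    using measurable_sets[OF measurable_affine_map K_sets, of 1] by simp
qed

lemma dilate_1: "dilate 1 = K"
proof -
  have "affine_map n 1 (\<lambda>_. 0) x = x" if "x \<in> space (lebesgue_n n)" for x
    using that by (auto simp: affine_map_def space_lebesgue_n PiE_def extensional_def)
  then show ?thesis
    using K_space by (auto simp: dilate_def)
qed

lemma vol_dilate_1: "vol_dilate 1 = gauss_vol n K"
  by (simp add: dilate_1 gauss_vol_def)

lemma dilate_mono:
  assumes "0 < s" "s \<le> t"
  shows "dilate s \<subseteq> dilate t"
proof
  fix x assume x: "x \<in> dilate s"
  then show "x \<in> dilate t"
    using assms K_scale[of "affine_map n (1 / s) (\<lambda>_. 0) x" "s / t" "affine_map n (1 / t) (\<lambda>_. 0) x"]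
    by (auto simp: dilate_def affine_map_def space_lebesgue_n)
qed

lemma vol_dilate_mono: "0 < s \<Longrightarrow> s \<le> t \<Longrightarrow> vol_dilate s \<le> vol_dilate t"
  by (rule std_gaussian.finite_measure_mono[OF dilate_mono]) (simp_all add: dilate_sets)

text \<open>Midpoint log-concavity of the volume in the dilation factor. The midpoint of
  \<open>x\<close> and \<open>y\<close>, scaled by \<open>2 / (s + t)\<close>, is the combination of
  \<open>x / s\<close> and \<open>y / t\<close> with weights \<open>s / (s + t)\<close> and
  \<open>t / (s + t)\<close>.\<close>

lemma vol_dilate_midpoint:
  assumes "0 < s" "0 < t"
  shows "vol_dilate s * vol_dilate t \<le> (vol_dilate ((s + t) / 2))\<^sup>2"
proof -
  have [simp]: "s \<noteq> 0" "t \<noteq> 0" "(s + t) / 2 \<noteq> 0" "s + t \<noteq> 0" using assms by auto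
  have [measurable]: "dilate s \<in> sets (lebesgue_n n)" "dilate t \<in> sets (lebesgue_n n)"
    "dilate ((s + t) / 2) \<in> sets (lebesgue_n n)" by (simp_all add: dilate_sets)
  have "(\<integral>\<^sup>+x. indicator (dilate s) x \<partial>std_gaussian n) * (\<integral>\<^sup>+x. indicator (dilate t) x \<partial>std_gaussian n)
      \<le> (\<integral>\<^sup>+x. indicator (dilate ((s + t) / 2)) x \<partial>std_gaussian n)\<^sup>2"
  proof (rule prekopa_leindler_gaussian)
    fix x y assume xy: "x \<in> space (lebesgue_n n)" "y \<in> space (lebesgue_n n)"
    have "mid_point x y \<in> dilate ((s + t) / 2)" if "x \<in> dilate s" "y \<in> dilate t"
    proof -
      have "mid_point x y \<in> space (lebesgue_n n)"
        using xy by (auto simp: mid_point_def space_lebesgue_n PiE_def extensional_def)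
      moreover have "affine_map n (1 / ((s + t) / 2)) (\<lambda>_. 0) (mid_point x y) \<in> K"
      proof (rule K_convex)
        show "affine_map n (1 / s) (\<lambda>_. 0) x \<in> K" "affine_map n (1 / t) (\<lambda>_. 0) y \<in> K"
          using that by (auto simp: dilate_def)
        show "s / (s + t) + t / (s + t) = 1" by (simp add: add_divide_distrib[symmetric])
      qed (use assms in \<open>auto simp: affine_map_def mid_point_def add_divide_distrib space_lebesgue_n\<close>)
      ultimately show ?thesis by (simp add: dilate_def)
    qed
    moreover have "1 \<le> ennreal (exp (sq_norm n (\<lambda>i. x i - y i) / 4))" by simp
    ultimately show "indicator (dilate s) x * indicator (dilate t) y
        \<le> (indicator (dilate ((s + t) / 2)) (mid_point x y))\<^sup>2 * ennreal (exp (sq_norm n (\<lambda>i. x i - y i) / 4))"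
      by (auto simp: indicator_def)
  qed auto
  then show ?thesis
    by (simp add: std_gaussian.emeasure_eq_measure ennreal_mult'[symmetric] ennreal_power)
qed

section \<open>Growth of the volume of dilates and the mean squared norm\<close>

text \<open>The mean squared norm under the truncated Gaussian, as
  \<open>integral_sq_norm_truncated\<close> confirms. It is written over
  \<open>std_gaussian\<close>, where the volume estimates take place.\<close>

definition mean_sq :: real where
  "mean_sq = (\<integral>x. sq_norm n x * indicator K x \<partial>std_gaussian n) / gauss_vol n K"

lemma integrable_sq_norm_K: "integrable (std_gaussian n) (\<lambda>x. sq_norm n x * indicator K x)"
  by (rule integrable_real_mult_indicator[OF _ integrable_sq_norm]) simp

lemma mean_sq_nonneg: "0 \<le> mean_sq"
  using vol_pos by (auto simp: mean_sq_def intro!: divide_nonneg_pos integral_nonneg)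

lemma sq_norm_affine_0: "sq_norm n (affine_map n t (\<lambda>_. 0) x) = t\<^sup>2 * sq_norm n x"
  unfolding sq_norm_def sum_distrib_left by (intro sum.cong) (auto simp: affine_map_def power_mult_distrib)

text \<open>Substituting \<open>t * x\<close> for \<open>x\<close> moves \<open>t\<close> from the
  set into the integrand. The logarithmic derivative of the right-hand side at \<open>t = 1\<close>
  is, formally, \<open>n - mean_sq\<close>.\<close>

lemma vol_dilate_eq:
  assumes "t > 0"
  shows "emeasure (std_gaussian n) (dilate t)
    = ennreal (t ^ n) * (\<integral>\<^sup>+x. exp ((1 - t\<^sup>2) * sq_norm n x / 2) * indicator K x \<partial>std_gaussian n)"
proof -
  have [measurable]: "dilate t \<in> sets (lebesgue_n n)" using assms by (simp add: dilate_sets)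
  have "emeasure (std_gaussian n) (dilate t) = (\<integral>\<^sup>+x. indicator (dilate t) x \<partial>std_gaussian n)"
    by simp
  also have "\<dots> = (\<integral>\<^sup>+x. ennreal (gauss_density n x) * indicator (dilate t) x \<partial>lebesgue_n n)"
    by (rule nn_integral_std_gaussian) simp
  also have "\<dots> = ennreal (\<bar>t\<bar> ^ n) * (\<integral>\<^sup>+x. ennreal (gauss_density n (affine_map n t (\<lambda>_. 0) x)) *
      indicator (dilate t) (affine_map n t (\<lambda>_. 0) x) \<partial>lebesgue_n n)"
    by (rule nn_integral_lebesgue_n_affine) (use assms in auto)
  also have "(\<integral>\<^sup>+x. ennreal (gauss_density n (affine_map n t (\<lambda>_. 0) x)) *
      indicator (dilate t) (affine_map n t (\<lambda>_. 0) x) \<partial>lebesgue_n n)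
     = (\<integral>\<^sup>+x. ennreal (gauss_density n x) * ennreal (exp ((1 - t\<^sup>2) * sq_norm n x / 2) * indicator K x) \<partial>lebesgue_n n)"
  proof (rule nn_integral_cong)
    fix x assume x: "x \<in> space (lebesgue_n n)"
    have "affine_map n (1 / t) (\<lambda>_. 0) (affine_map n t (\<lambda>_. 0) x) = x"
      using x assms by (auto simp: affine_map_def space_lebesgue_n PiE_def extensional_def)
    then have "indicator (dilate t) (affine_map n t (\<lambda>_. 0) x) = (indicator K x :: ennreal)"
      by (simp add: dilate_def indicator_def)
    moreover have "gauss_density n (affine_map n t (\<lambda>_. 0) x) = gauss_density n x * exp ((1 - t\<^sup>2) * sq_norm n x / 2)"
      by (simp add: gauss_density_eq sq_norm_affine_0 exp_add[symmetric] mult.assoc) (simp add: field_simps)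
    ultimately show "ennreal (gauss_density n (affine_map n t (\<lambda>_. 0) x)) * indicator (dilate t) (affine_map n t (\<lambda>_. 0) x)
      = ennreal (gauss_density n x) * ennreal (exp ((1 - t\<^sup>2) * sq_norm n x / 2) * indicator K x)"
      by (auto simp: indicator_def ennreal_mult'[symmetric] less_imp_le gauss_density_pos)
  qed
  also have "\<dots> = (\<integral>\<^sup>+x. exp ((1 - t\<^sup>2) * sq_norm n x / 2) * indicator K x \<partial>std_gaussian n)"
    by (rule nn_integral_std_gaussian[symmetric]) measurable
  finally show ?thesis using assms by simp
qed

text \<open>Jensen's inequality for \<open>exp\<close> applied to \<open>vol_dilate_eq\<close>.\<close>
lemma vol_dilate_ge:
  assumes "0 < t" "t \<le> 1"
  shows "t ^ n * (exp ((1 - t\<^sup>2) * mean_sq / 2) * gauss_vol n K) \<le> vol_dilate t"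
proof -
  define c where "c = (1 - t\<^sup>2) / 2"
  have c: "c \<ge> 0" using assms by (simp add: c_def power_le_one)
  define w where "w x = exp (c * sq_norm n x) * indicator K x" for x
  have [measurable]: "w \<in> borel_measurable (std_gaussian n)"
    unfolding w_def measurable_cong_sets[OF sets_std_gaussian refl] by measurable
  have w_nonneg: "0 \<le> w x" for x by (simp add: w_def)
  have eq: "emeasure (std_gaussian n) (dilate t) = ennreal (t ^ n) * (\<integral>\<^sup>+x. ennreal (w x) \<partial>std_gaussian n)"
    by (subst vol_dilate_eq[OF assms(1)])
      (auto intro!: arg_cong2[where f="(*)"] nn_integral_cong simp: w_def c_def ennreal_mult' indicator_def)
  \<comment> \<open>The exponent is nonnegative here, so integrability of \<open>w\<close> is not
    clear from its form; it follows because \<open>t ^ n\<close> times the integral is a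
    probability.\<close>
  have fin: "(\<integral>\<^sup>+x. ennreal (w x) \<partial>std_gaussian n) < \<infinity>"
  proof (rule ccontr)
    assume "\<not> ?thesis"
    then have "emeasure (std_gaussian n) (dilate t) = \<infinity>"
      using assms by (auto simp: eq ennreal_mult_eq_top_iff not_less top_unique)
    then show False by (simp add: std_gaussian.emeasure_eq_measure)
  qed
  have int: "integrable (std_gaussian n) w"
    by (rule integrableI_bounded) (use fin in \<open>auto simp: w_def\<close>)
  have V: "vol_dilate t = t ^ n * (\<integral>x. w x \<partial>std_gaussian n)"
  proof -
    have "ennreal (vol_dilate t) = ennreal (t ^ n * (\<integral>x. w x \<partial>std_gaussian n))"
      using assms eq nn_integral_eq_integral[OF int]
      by (simp add: std_gaussian.emeasure_eq_measure ennreal_mult' w_nonneg)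
    then show ?thesis using assms by (subst (asm) ennreal_inj) (auto simp: w_nonneg intro!: integral_nonneg mult_nonneg_nonneg)
  qed
  have le: "exp (c * mean_sq) * ((1 - c * mean_sq) * indicator K x + c * (sq_norm n x * indicator K x)) \<le> w x" for x
  proof -
    have "exp (c * mean_sq) * (1 + (c * sq_norm n x - c * mean_sq))
        \<le> exp (c * mean_sq) * exp (c * sq_norm n x - c * mean_sq)"
      by (intro mult_left_mono exp_ge_add_one_self) auto
    then show ?thesis by (auto simp: w_def indicator_def exp_add[symmetric] algebra_simps)
  qed
  have K_int: "integrable (std_gaussian n) (\<lambda>x. indicator K x :: real)"
    by (simp add: integrable_indicator_iff std_gaussian.emeasure_eq_measure)
  have "(\<integral>x. exp (c * mean_sq) * ((1 - c * mean_sq) * indicator K x + c * (sq_norm n x * indicator K x)) \<partial>std_gaussian n)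
      = exp (c * mean_sq) * ((1 - c * mean_sq) * gauss_vol n K + c * (mean_sq * gauss_vol n K))"
    using vol_pos by (simp add: integrable_sq_norm_K K_int mean_sq_def gauss_vol_def[symmetric])
  also have "\<dots> = exp (c * mean_sq) * gauss_vol n K" by (simp add: algebra_simps)
  finally have "exp (c * mean_sq) * gauss_vol n K \<le> (\<integral>x. w x \<partial>std_gaussian n)"
    using integral_mono[OF _ int le] by (simp add: integrable_sq_norm_K K_int)
  then show ?thesis
    unfolding V using assms by (intro mult_left_mono) (auto simp: c_def)
qed

lemma vol_dilate_pos:
  assumes "t > 0"
  shows "vol_dilate t > 0"
proof (cases "t \<le> 1")
  case True
  have "0 < t ^ n * (exp ((1 - t\<^sup>2) * mean_sq / 2) * gauss_vol n K)"
    using assms vol_pos by simp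
  also note vol_dilate_ge[OF assms True]
  finally show ?thesis .
next
  case False
  then show ?thesis using vol_pos vol_dilate_mono[of 1 t] by (simp add: vol_dilate_1)
qed

end

lemma concave_sequence_increments:
  fixes a :: "nat \<Rightarrow> real"
  assumes "\<And>j. a (Suc (Suc j)) - a (Suc j) \<le> a (Suc j) - a j"
  shows "a (Suc (i + k)) - a (Suc i) \<le> k * (a 1 - a 0)"
proof -
  have inc: "a (Suc j) - a j \<le> a 1 - a 0" for j
  proof (induction j)
    case (Suc j)
    then show ?case using assms[of j] by simp
  qed simp
  show ?thesis
  proof (induction k)
    case (Suc k)
    then show ?case using inc[of "Suc (i + k)"] by (simp add: algebra_simps)
  qed simp
qed

context symm_convex_set
begin

text \<open>By log-concavity the growth rate of the volume of dilates at \<open>t = 1\<close> dominates all later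
  ones; \<open>n - mean_sq\<close> is its derivative there.\<close>
lemma ln_vol_dilate_slope:
  fixes s T :: nat
  assumes "1 \<le> s" "s \<le> T"
  shows "ln (vol_dilate T) - ln (vol_dilate s) \<le> (real T - real s) * (real n - mean_sq)"
proof -
  have bound: "ln (vol_dilate T) - ln (vol_dilate s)
      \<le> (real T - real s) * (real n * (N / (N - 1)) - mean_sq * (1 - 1 / (2 * N)))"
    if N: "2 \<le> N" for N :: nat
  proof -
    \<comment> \<open>Index \<open>j\<close> stands for the dilation factor
      \<open>1 + (j - 1) / N\<close>. So \<open>a 1\<close> sits at factor 1 and \<open>a 0\<close>
      just below it, in the range of \<open>vol_dilate_ge\<close>; \<open>N >= 2\<close> keeps all
      factors positive. Integer factors \<open>s\<close> and \<open>T\<close> are grid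
      points.\<close>
    define a where "a j = ln (vol_dilate (1 + (real j - 1) / N))" for j :: nat
    have pos: "0 < 1 + (real j - 1) / N" for j
      using N by (simp add: field_simps add_pos_nonneg)
    have "a (Suc (Suc j)) - a (Suc j) \<le> a (Suc j) - a j" for j
    proof -
      have "vol_dilate (1 + (real j - 1) / N) * vol_dilate (1 + (real (Suc (Suc j)) - 1) / N)
          \<le> (vol_dilate ((1 + (real j - 1) / N + (1 + (real (Suc (Suc j)) - 1) / N)) / 2))\<^sup>2"
        by (rule vol_dilate_midpoint[OF pos pos])
      also have "(1 + (real j - 1) / N + (1 + (real (Suc (Suc j)) - 1) / N)) / 2 = 1 + (real (Suc j) - 1) / N"
        using N by (simp add: field_simps)
      finally have "ln (vol_dilate (1 + (real j - 1) / N) * vol_dilate (1 + (real (Suc (Suc j)) - 1) / N))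
          \<le> ln ((vol_dilate (1 + (real (Suc j) - 1) / N))\<^sup>2)"
        using vol_dilate_pos[OF pos[of j]] vol_dilate_pos[OF pos[of "Suc (Suc j)"]] by (intro ln_mono mult_pos_pos)
      then have "a j + a (Suc (Suc j)) \<le> 2 * a (Suc j)"
        unfolding a_def using vol_dilate_pos[OF pos[of j]] vol_dilate_pos[OF pos[of "Suc (Suc j)"]] by (subst (asm) ln_mult_pos) (auto simp: ln_realpow)
      then show ?thesis by simp
    qed
    from concave_sequence_increments[of a, OF this, of "N * (s - 1)" "N * (T - s)"]
    have "a (Suc (N * (s - 1) + N * (T - s))) - a (Suc (N * (s - 1))) \<le> real (N * (T - s)) * (a 1 - a 0)" .
    moreover have "a (Suc (N * (s - 1) + N * (T - s))) = ln (vol_dilate T)"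
      using assms N by (simp add: a_def of_nat_diff add_divide_distrib)
    moreover have "a (Suc (N * (s - 1))) = ln (vol_dilate s)"
      using assms N by (simp add: a_def of_nat_diff)
    ultimately have le: "ln (vol_dilate T) - ln (vol_dilate s) \<le> real (N * (T - s)) * (a 1 - a 0)" by simp
    define t where "t = 1 - 1 / real N"
    have t: "0 < t" "t \<le> 1" using N by (auto simp: t_def field_simps)
    have "ln (t ^ n * (exp ((1 - t\<^sup>2) * mean_sq / 2) * gauss_vol n K)) \<le> ln (vol_dilate t)"
      using t vol_pos vol_dilate_ge[OF t] by (intro ln_mono) auto
    then have "n * ln t + (1 - t\<^sup>2) * mean_sq / 2 + ln (gauss_vol n K) \<le> ln (vol_dilate t)"
      using t vol_pos by (simp add: ln_mult_pos ln_realpow)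
    then have "a 1 - a 0 \<le> - (n * ln t) - (1 - t\<^sup>2) * mean_sq / 2"
      by (simp add: a_def t_def vol_dilate_1)
    also have "- (n * ln t) \<le> n * (1 / (N - 1))"
    proof -
      have "- ln t = ln (1 / t)" using t by (simp add: ln_div)
      also have "\<dots> \<le> 1 / t - 1" using t by (intro ln_le_minus_one) auto
      also have "\<dots> = 1 / (N - 1)" using N by (simp add: t_def field_simps of_nat_diff)
      finally have "n * (- ln t) \<le> n * (1 / (N - 1))" by (intro mult_left_mono) auto
      then show ?thesis by simp
    qed
    finally have "real (N * (T - s)) * (a 1 - a 0) \<le> real (N * (T - s)) * (n * (1 / (N - 1)) - (1 - t\<^sup>2) * mean_sq / 2)"
      by (intro mult_left_mono) auto
    also have "\<dots> = (real T - real s) * (real n * (N / (N - 1)) - mean_sq * (N * (1 - t\<^sup>2) / 2))"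
      using assms by (simp add: of_nat_diff algebra_simps diff_divide_distrib)
    also have "N * (1 - t\<^sup>2) / 2 = 1 - 1 / (2 * N)"
      using N by (simp add: t_def power2_eq_square field_simps)
    finally show ?thesis using le by simp
  qed
  \<comment> \<open>Taking \<open>N = k + 1\<close> in \<open>bound\<close> bounds the
    discretisation error by a multiple of \<open>1 / k\<close>, which vanishes in the limit.\<close>
  have "ln (vol_dilate T) - ln (vol_dilate s)
      \<le> (real T - real s) * (real n - mean_sq + (real n + mean_sq) * (1 / real k))" if k: "1 \<le> k" for k :: nat
  proof -
    have "real (Suc k) / (real (Suc k) - 1) = 1 + 1 / real k"
      using k by (simp add: field_simps)
    then have "real n * (real (Suc k) / (real (Suc k) - 1)) - mean_sq * (1 - 1 / (2 * real (Suc k)))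
        = real n - mean_sq + (real n * (1 / real k) + mean_sq * (1 / (2 * real (Suc k))))"
      by (simp only:) (simp add: right_diff_distrib distrib_left)
    also have "\<dots> \<le> real n - mean_sq + (real n * (1 / real k) + mean_sq * (1 / real k))"
      using k mean_sq_nonneg by (intro add_left_mono mult_left_mono divide_left_mono) auto
    finally have "(real T - real s) * (real n * (real (Suc k) / real (Suc k - 1)) - mean_sq * (1 - 1 / real (2 * Suc k)))
        \<le> (real T - real s) * (real n - mean_sq + (real n + mean_sq) * (1 / real k))"
      using assms by (intro mult_left_mono) (auto simp: algebra_simps)
    with bound[of "Suc k"] k show ?thesis by linarith
  qed
  moreover have "(\<lambda>k::nat. (real T - real s) * (real n - mean_sq + (real n + mean_sq) * (1 / real k)))
      \<longlonglongrightarrow> (real T - real s) * (real n - mean_sq + (real n + mean_sq) * 0)"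
    by (intro tendsto_intros lim_1_over_n)
  ultimately show ?thesis
    using LIMSEQ_le_const[of _ "(real T - real s) * (real n - mean_sq + (real n + mean_sq) * 0)"
        "ln (vol_dilate T) - ln (vol_dilate s)"] by fastforce
qed

end

section \<open>Dimension-free lower bounds on n - mean_sq\<close>

context symm_convex_set
begin

lemma vol_le_1: "gauss_vol n K \<le> 1"
  by (simp add: gauss_vol_def)

text \<open>If \<open>y\<close> and the midpoint of \<open>x\<close> and \<open>y\<close> lie in
  \<open>K\<close>, then \<open>x / 3\<close> is \<open>2 / 3\<close> of the midpoint minus
  \<open>1 / 3\<close> of \<open>y\<close>, hence in \<open>K\<close>. Midpoints between the
  complement of \<open>3 K\<close> and \<open>K\<close> therefore avoid \<open>K\<close>.\<close>

lemma borell_dilate_3: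
  "(1 - vol_dilate 3) * gauss_vol n K \<le> (1 - gauss_vol n K)\<^sup>2"
proof -
  let ?S = "space (lebesgue_n n)"
  have [measurable]: "dilate 3 \<in> sets (lebesgue_n n)" by (simp add: dilate_sets)
  have "(\<integral>\<^sup>+x. indicator (?S - dilate 3) x \<partial>std_gaussian n) * (\<integral>\<^sup>+x. indicator K x \<partial>std_gaussian n)
      \<le> (\<integral>\<^sup>+x. indicator (?S - K) x \<partial>std_gaussian n)\<^sup>2"
  proof (rule prekopa_leindler_gaussian)
    fix x y assume xy: "x \<in> ?S" "y \<in> ?S"
    have "x \<in> dilate 3" if "y \<in> K" "mid_point x y \<in> K"
    proof -
      have "affine_map n (1 / 3) (\<lambda>_. 0) x \<in> K"
        by (rule K_absconvex[OF that(2,1), of "2 / 3" "- 1 / 3"])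
          (auto simp: affine_map_def mid_point_def space_lebesgue_n field_simps)
      then show ?thesis using xy by (simp add: dilate_def)
    qed
    moreover have "mid_point x y \<in> ?S"
      using xy by (auto simp: mid_point_def space_lebesgue_n PiE_def extensional_def)
    moreover have "1 \<le> ennreal (exp (sq_norm n (\<lambda>i. x i - y i) / 4))" by simp
    ultimately show "indicator (?S - dilate 3) x * indicator K y
        \<le> (indicator (?S - K) (mid_point x y))\<^sup>2 * ennreal (exp (sq_norm n (\<lambda>i. x i - y i) / 4))"
      by (auto simp: indicator_def)
  qed auto
  moreover have "measure (std_gaussian n) (?S - dilate 3) = 1 - vol_dilate 3"
      "measure (std_gaussian n) (?S - K) = 1 - gauss_vol n K"
    using std_gaussian.prob_compl[of "dilate 3" n] std_gaussian.prob_compl[of K n] by (auto simp: gauss_vol_def)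
  ultimately show ?thesis
    by (simp add: std_gaussian.emeasure_eq_measure ennreal_mult'[symmetric] ennreal_power gauss_vol_def)
qed

text \<open>The threshold \<open>2 / 3\<close> is where \<open>1 - p <= p / 2\<close>, so that
  Borell's lemma halves the missing mass on passing to \<open>3 K\<close>. The logarithm of the
  volume then grows by at least \<open>(1 - p) / 2\<close> over a dilation length of 2.\<close>

lemma deficit_large_volume:
  assumes "2 / 3 \<le> gauss_vol n K"
  shows "(1 - gauss_vol n K) / 4 \<le> real n - mean_sq"
proof -
  define p q where "p = gauss_vol n K" and "q = vol_dilate 3"
  have p: "2 / 3 \<le> p" "p \<le> 1" using assms vol_le_1 by (auto simp: p_def)
  have q: "p \<le> q" "q \<le> 1" using vol_dilate_mono[of 1 3] by (auto simp: p_def q_def vol_dilate_1)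
  have "(1 - q) * p \<le> (1 - p) * (1 - p)" using borell_dilate_3 by (simp add: p_def q_def power2_eq_square)
  also have "\<dots> \<le> (1 - p) * (p / 2)" using p by (intro mult_left_mono) auto
  finally have "(1 - q) * p \<le> (1 - p) / 2 * p" by simp
  then have "1 - q \<le> (1 - p) / 2" using p by (subst (asm) mult_le_cancel_right) auto
  then have "(1 - p) / 2 \<le> q - p" by simp
  also have "q - p \<le> ln q - ln p"
  proof -
    have "ln (p / q) \<le> p / q - 1" using p q by (intro ln_le_minus_one) auto
    moreover have "q - p \<le> (q - p) / q"
      using p q mult_left_mono[of q 1 "q - p"] by (simp add: pos_le_divide_eq)
    moreover have "(q - p) / q = 1 - p / q" using p q by (simp add: diff_divide_distrib)
    ultimately show ?thesis using p q by (simp add: ln_div)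
  qed
  also have "\<dots> \<le> 2 * (real n - mean_sq)"
    using ln_vol_dilate_slope[of 1 3] by (simp add: p_def q_def vol_dilate_1)
  finally show ?thesis by (simp add: p_def)
qed

text \<open>Shifting back gives the integral over \<open>K\<close> of the density at
  \<open>v + x\<close>, and by symmetry of \<open>K\<close> also that at \<open>v - x\<close>. With
  \<open>s\<close> the inner product of \<open>x\<close> and \<open>v\<close>, the two densities add
  up to \<open>exp (- sq_norm n v / 2)\<close> times the density at \<open>x\<close> times
  \<open>exp (- s) + exp s\<close>, and the last factor is at least 2.\<close>

lemma translate_vol_ge: "exp (- sq_norm n v / 2) * gauss_vol n K \<le> measure (std_gaussian n) (translate v)"
proof -
  let ?L = "lebesgue_n n"
  have int: "emeasure (std_gaussian n) (translate v) = (\<integral>\<^sup>+x. ennreal (gauss_density n x) * indicator (translate v) x \<partial>?L)"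
    using nn_integral_std_gaussian[of "indicator (translate v)" n] by simp
  have A: "emeasure (std_gaussian n) (translate v)
      = (\<integral>\<^sup>+x. ennreal (gauss_density n (affine_map n e v x)) * indicator K x \<partial>?L)" if "e = 1 \<or> e = -1" for e
  proof -
    have "emeasure (std_gaussian n) (translate v) = ennreal (\<bar>e\<bar> ^ n) *
      (\<integral>\<^sup>+x. ennreal (gauss_density n (affine_map n e v x)) * indicator (translate v) (affine_map n e v x) \<partial>?L)"
      unfolding int by (rule nn_integral_lebesgue_n_affine) (use that in auto)
    also have "(\<integral>\<^sup>+x. ennreal (gauss_density n (affine_map n e v x)) * indicator (translate v) (affine_map n e v x) \<partial>?L)
        = (\<integral>\<^sup>+x. ennreal (gauss_density n (affine_map n e v x)) * indicator K x \<partial>?L)"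
    proof (rule nn_integral_cong)
      fix x assume x: "x \<in> space ?L"
      let ?z = "affine_map n 1 (\<lambda>i. - v i) (affine_map n e v x)"
      have z: "?z i = e * x i" "x i = e * ?z i" if "i < n" for i
        using that \<open>e = 1 \<or> e = -1\<close> by (auto simp: affine_map_def)
      have "\<bar>e\<bar> \<le> 1" using that by auto
      then have "?z \<in> K \<longleftrightarrow> x \<in> K"
        using K_scale[OF _ _ x z(2)] K_scale[OF _ _ affine_map_in_space z(1)] by blast
      then show "ennreal (gauss_density n (affine_map n e v x)) * indicator (translate v) (affine_map n e v x)
          = ennreal (gauss_density n (affine_map n e v x)) * indicator K x"
        by (auto simp: translate_def indicator_def)
    qed
    finally show ?thesis using that by auto
  qed
  have [measurable]: "(\<lambda>x. gauss_density n (affine_map n e v x)) \<in> borel_measurable ?L" if "e \<noteq> 0" for e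
    using measurable_compose[OF measurable_affine_map[OF that] measurable_gauss_density] .
  have dens: "2 * (exp (- sq_norm n v / 2) * gauss_density n x)
      \<le> gauss_density n (affine_map n 1 v x) + gauss_density n (affine_map n (-1) v x)" for x
  proof -
    define s where "s = (\<Sum>i<n. x i * v i)"
    have sq: "sq_norm n (affine_map n e v x) = sq_norm n x + 2 * e * s + sq_norm n v" if "e = 1 \<or> e = -1" for e
      using that
      by (auto simp: sq_norm_def affine_map_def s_def power2_eq_square algebra_simps sum.distrib sum_distrib_left sum_subtractf)
    have "gauss_density n (affine_map n e v x) = exp (- sq_norm n v / 2) * gauss_density n x * exp (- e * s)"
      if "e = 1 \<or> e = -1" for e
      unfolding gauss_density_eq sq[OF that]
      by (simp add: exp_add[symmetric] mult.assoc mult.left_commute[of "exp _"])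
    then have eq: "gauss_density n (affine_map n 1 v x) + gauss_density n (affine_map n (-1) v x)
      = exp (- sq_norm n v / 2) * gauss_density n x * (exp (- s) + exp s)"
      by (simp add: algebra_simps)
    have "2 \<le> exp (- s) + exp s" using exp_ge_add_one_self[of s] exp_ge_add_one_self[of "-s"] by linarith
    then have "exp (- sq_norm n v / 2) * gauss_density n x * 2 \<le> exp (- sq_norm n v / 2) * gauss_density n x * (exp (- s) + exp s)"
      by (intro mult_left_mono) (auto simp: less_imp_le gauss_density_pos)
    then show ?thesis unfolding eq by simp
  qed
  have "ennreal 2 * (ennreal (exp (- sq_norm n v / 2)) * emeasure (std_gaussian n) K)
      = (\<integral>\<^sup>+x. ennreal 2 * (ennreal (exp (- sq_norm n v / 2)) * (ennreal (gauss_density n x) * indicator K x)) \<partial>?L)"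
    using nn_integral_std_gaussian[of "indicator K" n] by (simp add: nn_integral_cmult)
  also have "\<dots> \<le> (\<integral>\<^sup>+x. ennreal (gauss_density n (affine_map n 1 v x)) * indicator K x
      + ennreal (gauss_density n (affine_map n (-1) v x)) * indicator K x \<partial>?L)"
  proof (intro nn_integral_mono)
    fix x
    have "ennreal (2 * (exp (- sq_norm n v / 2) * gauss_density n x))
      \<le> ennreal (gauss_density n (affine_map n 1 v x) + gauss_density n (affine_map n (-1) v x))"
      by (intro ennreal_leI dens)
    then show "ennreal 2 * (ennreal (exp (- sq_norm n v / 2)) * (ennreal (gauss_density n x) * indicator K x))
      \<le> ennreal (gauss_density n (affine_map n 1 v x)) * indicator K x
        + ennreal (gauss_density n (affine_map n (-1) v x)) * indicator K x"
      by (auto simp: indicator_def ennreal_mult' ennreal_plus less_imp_le gauss_density_pos)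
  qed
  also have "\<dots> = emeasure (std_gaussian n) (translate v) + emeasure (std_gaussian n) (translate v)"
    by (subst nn_integral_add) (auto simp: A[of 1, symmetric] A[of "-1", symmetric])
  also have "\<dots> = ennreal 2 * emeasure (std_gaussian n) (translate v)" by (simp add: mult_2)
  finally have "ennreal (2 * (exp (- sq_norm n v / 2) * gauss_vol n K)) \<le> ennreal (2 * measure (std_gaussian n) (translate v))"
    by (simp add: std_gaussian.emeasure_eq_measure gauss_vol_def ennreal_mult')
  then show ?thesis by (subst (asm) ennreal_le_iff) auto
qed

text \<open>A point common to the translates by \<open>2 * j * b\<close> and
  \<open>2 * k * b\<close> yields two points of \<open>K\<close> that differ by
  \<open>2 * (k - j) * b\<close>. Half their difference is a nonzero integer multiple of
  \<open>b\<close> in \<open>K\<close>, which would put \<open>b\<close> itself into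
  \<open>K\<close>.\<close>

lemma disjoint_translates:
  fixes I :: "int set"
  assumes b: "b \<in> space (lebesgue_n n)" "b \<notin> K" and I: "finite I"
  shows "(\<Sum>j\<in>I. exp (- (2 * (real_of_int j)\<^sup>2 * sq_norm n b))) * gauss_vol n K
    \<le> measure (std_gaussian n) (\<Union>j\<in>I. translate (\<lambda>i. 2 * real_of_int j * b i))"
proof -
  let ?T = "\<lambda>j::int. translate (\<lambda>i. 2 * real_of_int j * b i)"
  have disj: "disjoint_family_on ?T I"
    unfolding disjoint_family_on_def
  proof (intro ballI impI, rule ccontr)
    fix j k assume jk: "j \<noteq> k" and "?T j \<inter> ?T k \<noteq> {}"
    then obtain x where x: "x \<in> ?T j" "x \<in> ?T k" by auto
    define d where "d = real_of_int k - real_of_int j"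
    have d: "1 \<le> \<bar>d\<bar>" "d \<noteq> 0" using jk unfolding d_def by linarith+
    have "b \<in> K"
    proof (rule K_absconvex)
      show "affine_map n 1 (\<lambda>i. - (2 * real_of_int j * b i)) x \<in> K" "affine_map n 1 (\<lambda>i. - (2 * real_of_int k * b i)) x \<in> K"
        using x by (auto simp: translate_def)
      show "\<bar>1 / (2 * d)\<bar> + \<bar>- 1 / (2 * d)\<bar> \<le> 1" using d by (simp add: abs_mult field_simps)
      show "b i = 1 / (2 * d) * affine_map n 1 (\<lambda>i. - (2 * real_of_int j * b i)) x i
          + - 1 / (2 * d) * affine_map n 1 (\<lambda>i. - (2 * real_of_int k * b i)) x i" if "i < n" for i
      proof -
        have "affine_map n 1 (\<lambda>i. - (2 * real_of_int j * b i)) x i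
            - affine_map n 1 (\<lambda>i. - (2 * real_of_int k * b i)) x i = 2 * d * b i" (is "?P - ?Q = _")
          using that by (simp add: affine_map_def d_def algebra_simps)
        then have "b i = (?P - ?Q) / (2 * d)" using d by simp
        then show ?thesis by (simp add: diff_divide_distrib)
      qed
    qed (rule b)
    then show False using b by simp
  qed
  have "(\<Sum>j\<in>I. exp (- (2 * (real_of_int j)\<^sup>2 * sq_norm n b))) * gauss_vol n K
      = (\<Sum>j\<in>I. exp (- sq_norm n (\<lambda>i. 2 * real_of_int j * b i) / 2) * gauss_vol n K)"
    by (simp add: sum_distrib_right sq_norm_def power_mult_distrib sum_distrib_left[symmetric] mult.assoc)
  also have "\<dots> \<le> (\<Sum>j\<in>I. measure (std_gaussian n) (?T j))"
    by (intro sum_mono translate_vol_ge)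
  also have "\<dots> = measure (std_gaussian n) (\<Union>j\<in>I. ?T j)"
    by (rule std_gaussian.finite_measure_finite_Union[symmetric]) (use I disj in auto)
  finally show ?thesis .
qed

text \<open>Positive volume makes \<open>K\<close> absorbing. If \<open>a / J\<close> were outside
  \<open>K\<close> for every \<open>J\<close>, then \<open>J\<close> disjoint translates by even
  multiples of \<open>a / J\<close> would each have volume at least \<open>q\<close>, independent of
  \<open>J\<close>, and their total would exceed 1.\<close>

lemma some_multiple_in_K:
  assumes a: "a \<in> space (lebesgue_n n)"
  shows "\<exists>J::nat. 1 \<le> J \<and> affine_map n (1 / J) (\<lambda>_. 0) a \<in> K"
proof (rule ccontr)
  assume contr: "\<not> ?thesis"
  define q where "q = exp (- (2 * sq_norm n a)) * gauss_vol n K"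
  have "q > 0" using vol_pos by (simp add: q_def)
  then obtain J :: nat where J: "1 < J * q" using reals_Archimedean3 by blast
  then have J0: "1 \<le> J" by (cases J) auto
  let ?b = "affine_map n (1 / J) (\<lambda>_. 0) a"
  have b: "?b \<in> space (lebesgue_n n)" "?b \<notin> K" using contr J0 by auto
  have "J * q = (\<Sum>j\<in>{1..int J}. exp (- (2 * sq_norm n a))) * gauss_vol n K"
    by (simp add: q_def)
  also have "\<dots> \<le> (\<Sum>j\<in>{1..int J}. exp (- (2 * (real_of_int j)\<^sup>2 * sq_norm n ?b))) * gauss_vol n K"
  proof (intro mult_right_mono sum_mono)
    fix j assume j: "j \<in> {1..int J}"
    then have "(real_of_int j / J)\<^sup>2 \<le> 1\<^sup>2" using J0 by (intro power_mono) auto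
    then have "(real_of_int j / J)\<^sup>2 * sq_norm n a \<le> 1 * sq_norm n a"
      by (intro mult_right_mono) auto
    then show "exp (- (2 * sq_norm n a)) \<le> exp (- (2 * (real_of_int j)\<^sup>2 * sq_norm n ?b))"
      by (simp add: sq_norm_affine_0 power_divide field_simps)
  qed (use vol_pos in auto)
  also have "\<dots> \<le> measure (std_gaussian n) (\<Union>j\<in>{1..int J}. translate (\<lambda>i. 2 * real_of_int j * ?b i))"
    by (rule disjoint_translates[OF b]) simp
  also have "\<dots> \<le> 1" by simp
  finally show False using J by simp
qed

text \<open>If a short vector \<open>b \<notin> K\<close> satisfies \<open>b \<in> 2K\<close>, then \<open>K\<close> and its translates by \<open>\<plusminus>2b\<close> are
  disjoint and fit into \<open>5K\<close>.\<close>
lemma deficit_thin: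
  assumes a: "a \<in> space (lebesgue_n n)" "a \<notin> K" "sq_norm n a \<le> 1"
  shows "1 / 22 \<le> real n - mean_sq"
proof -
  \<comment> \<open>Minimality of \<open>J\<close> gives the vector of the preceding comment:
    \<open>?b = a / (J - 1)\<close> is outside \<open>K\<close>, while half of it is
    \<open>J / (2 * (J - 1))\<close> times \<open>a / J\<close>, a factor of at most 1 since
    \<open>J >= 2\<close>.\<close>
  define J where "J = (LEAST J::nat. 1 \<le> J \<and> affine_map n (1 / J) (\<lambda>_. 0) a \<in> K)"
  have J: "1 \<le> J" "affine_map n (1 / J) (\<lambda>_. 0) a \<in> K"
    using LeastI_ex[OF some_multiple_in_K[OF a(1)]] unfolding J_def by auto
  have "affine_map n 1 (\<lambda>_. 0) a = a"
    using a(1) by (auto simp: affine_map_def space_lebesgue_n PiE_def extensional_def)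
  then have J2: "2 \<le> J" using J a by (cases "J = 1") auto
  let ?b = "affine_map n (1 / (J - 1)) (\<lambda>_. 0) a"
  have b: "?b \<in> space (lebesgue_n n)" "?b \<notin> K"
    using not_less_Least[of "J - 1" "\<lambda>J. 1 \<le> J \<and> affine_map n (1 / J) (\<lambda>_. 0) a \<in> K"] J2
    unfolding J_def[symmetric] by auto
  have half: "affine_map n (1 / 2) (\<lambda>_. 0) ?b \<in> K"
    by (rule K_scale[OF J(2), of "real J / (2 * (real J - 1))"])
      (use J2 in \<open>auto simp: affine_map_def space_lebesgue_n of_nat_diff field_simps\<close>)
  have "sq_norm n ?b = (1 / real (J - 1))\<^sup>2 * sq_norm n a"
    by (rule sq_norm_affine_0)
  also have "\<dots> \<le> 1 * 1"
    using J2 a by (intro mult_mono power_le_one) auto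
  finally have sqb: "sq_norm n ?b \<le> 1" by simp
  \<comment> \<open>The middle copy contributes 1 and each outer copy at least
    \<open>exp (- 2) >= 1 / 9\<close>. In the end \<open>ln (11 / 9) >= 2 / 11\<close>, spread over
    the dilation length 4, gives \<open>1 / 22\<close>.\<close>
  have "11 / 9 * gauss_vol n K \<le> (\<Sum>j\<in>{-1, 0, 1}. exp (- (2 * (real_of_int j)\<^sup>2 * sq_norm n ?b))) * gauss_vol n K"
  proof (intro mult_right_mono)
    have "exp 2 = (exp 1 :: real)\<^sup>2" by (simp add: exp_double[symmetric])
    also have "\<dots> \<le> 3\<^sup>2" using exp_le by (intro power_mono) auto
    finally have "1 / 9 \<le> exp (- 2 :: real)" by (simp add: exp_minus field_simps)
    also have "\<dots> \<le> exp (- (2 * sq_norm n ?b))" using sqb by simp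
    finally show "11 / 9 \<le> (\<Sum>j\<in>{-1, 0, 1}. exp (- (2 * (real_of_int j)\<^sup>2 * sq_norm n ?b)))" by simp
  qed (use vol_pos in simp)
  also have "\<dots> \<le> measure (std_gaussian n) (\<Union>j\<in>{-1, 0, 1}. translate (\<lambda>i. 2 * real_of_int j * ?b i))"
    by (rule disjoint_translates[OF b]) simp
  also have "\<dots> \<le> vol_dilate 5"
  proof (rule std_gaussian.finite_measure_mono)
    have "x \<in> dilate 5" if x: "x \<in> translate (\<lambda>i. 2 * real_of_int j * ?b i)" "j \<in> {-1, 0, 1}" for x j
    proof -
      \<comment> \<open>\<open>x / 5\<close> is \<open>1 / 5\<close> of the point
        \<open>x - 2 * j * b\<close> of \<open>K\<close> plus \<open>4 * j / 5\<close> of the point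
        \<open>b / 2\<close> of \<open>K\<close>.\<close>
      have "affine_map n (1 / 5) (\<lambda>_. 0) x \<in> K"
      proof (rule K_absconvex)
        show "affine_map n 1 (\<lambda>i. - (2 * real_of_int j * ?b i)) x \<in> K" using x by (auto simp: translate_def)
        show "\<bar>1 / 5\<bar> + \<bar>4 / 5 * real_of_int j\<bar> \<le> (1::real)" using x by auto
      qed (use x half in \<open>auto simp: affine_map_def field_simps space_lebesgue_n\<close>)
      then show ?thesis using x by (auto simp: dilate_def translate_def)
    qed
    then show "(\<Union>j\<in>{-1, 0, 1}. translate (\<lambda>i. 2 * real_of_int j * ?b i)) \<subseteq> dilate 5" by blast
  qed (simp add: dilate_sets)
  finally have "ln (11 / 9 * gauss_vol n K) \<le> ln (vol_dilate 5)"
    using vol_pos by (intro ln_mono) auto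
  then have "ln (11 / 9) \<le> ln (vol_dilate 5) - ln (gauss_vol n K)"
    using vol_pos by (subst (asm) ln_mult_pos) auto
  also have "\<dots> \<le> 4 * (real n - mean_sq)"
    using ln_vol_dilate_slope[of 1 5] by (simp add: vol_dilate_1)
  finally have "ln (11 / 9) \<le> 4 * (real n - mean_sq)" .
  moreover have "ln (9 / 11 :: real) \<le> 9 / 11 - 1" by (intro ln_le_minus_one) auto
  moreover have "ln (9 / 11 :: real) = - ln (11 / 9)" by (simp add: ln_div)
  ultimately show ?thesis by simp
qed

text \<open>Points of \<open>s K\<close> and of the complement of \<open>(s + 4) K\<close> are at
  distance at least 4, since otherwise their difference would lie in \<open>4 K\<close>. The slack
  factor is then at least \<open>exp 4\<close>, which pays for the constant function
  \<open>exp (- 2)\<close> on the right.\<close>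

lemma concentration:
  assumes ball: "\<And>a. a \<in> space (lebesgue_n n) \<Longrightarrow> sq_norm n a \<le> 1 \<Longrightarrow> a \<in> K" and s: "0 < s"
  shows "vol_dilate s * (1 - vol_dilate (s + 4)) \<le> exp (- 4)"
proof -
  let ?S = "space (lebesgue_n n)"
  have [measurable]: "dilate s \<in> sets (lebesgue_n n)" "dilate (s + 4) \<in> sets (lebesgue_n n)"
    using s by (auto simp: dilate_sets)
  have "(\<integral>\<^sup>+x. indicator (dilate s) x \<partial>std_gaussian n) * (\<integral>\<^sup>+x. indicator (?S - dilate (s + 4)) x \<partial>std_gaussian n)
      \<le> (\<integral>\<^sup>+x. ennreal (exp (- 2)) \<partial>std_gaussian n)\<^sup>2"
  proof (rule prekopa_leindler_gaussian)
    fix x y assume xy: "x \<in> ?S" "y \<in> ?S"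
    have "16 \<le> sq_norm n (\<lambda>i. x i - y i)" if "x \<in> dilate s" "y \<notin> dilate (s + 4)"
    proof (rule ccontr)
      assume small: "\<not> ?thesis"
      let ?w = "\<lambda>i\<in>{..<n}. (y i - x i) / 4"
      have "sq_norm n ?w = sq_norm n (\<lambda>i. x i - y i) / 16"
        by (simp add: sq_norm_def power_divide power2_commute[of "y _"] sum_divide_distrib)
      then have w: "?w \<in> K" using small by (intro ball) (auto simp: space_lebesgue_n)
      have x: "affine_map n (1 / s) (\<lambda>_. 0) x \<in> K" using that by (simp add: dilate_def)
      have "affine_map n (1 / (s + 4)) (\<lambda>_. 0) y \<in> K"
      proof (rule K_absconvex[OF x w, of "s / (s + 4)" "4 / (s + 4)"])
        show "\<bar>s / (s + 4)\<bar> + \<bar>4 / (s + 4)\<bar> \<le> 1"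
          using s by (simp add: add_divide_distrib[symmetric])
        show "affine_map n (1 / (s + 4)) (\<lambda>_. 0) y i
            = s / (s + 4) * affine_map n (1 / s) (\<lambda>_. 0) x i + 4 / (s + 4) * ?w i" if "i < n" for i
          using that s by (simp add: affine_map_def diff_divide_distrib)
      qed simp
      then show False using that xy by (simp add: dilate_def)
    qed
    then have "x \<in> dilate s \<Longrightarrow> y \<notin> dilate (s + 4) \<Longrightarrow>
        1 \<le> (exp (- 2))\<^sup>2 * exp (sq_norm n (\<lambda>i. x i - y i) / 4)"
      by (simp add: exp_double[symmetric] exp_add[symmetric])
    then have "x \<in> dilate s \<Longrightarrow> y \<notin> dilate (s + 4) \<Longrightarrow>
        1 \<le> (ennreal (exp (- 2)))\<^sup>2 * ennreal (exp (sq_norm n (\<lambda>i. x i - y i) / 4))"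
      by (simp add: ennreal_power ennreal_mult'[symmetric])
    then show "indicator (dilate s) x * indicator (?S - dilate (s + 4)) y
        \<le> (ennreal (exp (- 2)))\<^sup>2 * ennreal (exp (sq_norm n (\<lambda>i. x i - y i) / 4))"
      by (auto simp: indicator_def)
  qed auto
  moreover have "measure (std_gaussian n) (?S - dilate (s + 4)) = 1 - vol_dilate (s + 4)"
    using std_gaussian.prob_compl[of "dilate (s + 4)" n] by auto
  moreover have "(exp (- 2 :: real))\<^sup>2 = exp (- 4)" by (simp add: exp_double[symmetric])
  moreover have "emeasure (std_gaussian n) ?S = 1"
    using std_gaussian.emeasure_space_1[of n] by simp
  ultimately show ?thesis
    by (simp add: std_gaussian.emeasure_eq_measure ennreal_mult'[symmetric] ennreal_power)
qed

text \<open>\<open>s K\<close> contains the ball of radius \<open>s\<close>. This only serves to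
  show that some dilate reaches volume \<open>2 / 3\<close>, so the dependence on \<open>n\<close>
  does no harm.\<close>

lemma vol_dilate_ge_Markov:
  assumes ball: "\<And>a. a \<in> space (lebesgue_n n) \<Longrightarrow> sq_norm n a \<le> 1 \<Longrightarrow> a \<in> K" and s: "0 < s"
  shows "1 - vol_dilate s \<le> real n / s\<^sup>2"
proof -
  let ?S = "space (lebesgue_n n)"
  have [measurable]: "dilate s \<in> sets (lebesgue_n n)" using s by (auto simp: dilate_sets)
  have "1 - vol_dilate s = measure (std_gaussian n) (?S - dilate s)"
    using std_gaussian.prob_compl[of "dilate s" n] by auto
  also have "\<dots> \<le> measure (std_gaussian n) {x \<in> space (std_gaussian n). s\<^sup>2 \<le> sq_norm n x}"
  proof (rule std_gaussian.finite_measure_mono)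
    have "x \<in> dilate s" if "x \<in> ?S" "sq_norm n x < s\<^sup>2" for x
    proof -
      have "affine_map n (1 / s) (\<lambda>_. 0) x \<in> K"
        using that s by (intro ball) (auto simp: sq_norm_affine_0 power_divide field_simps)
      then show ?thesis using that by (simp add: dilate_def)
    qed
    then show "?S - dilate s \<subseteq> {x \<in> space (std_gaussian n). s\<^sup>2 \<le> sq_norm n x}" by force
  qed measurable
  also have "\<dots> \<le> (\<integral>x. sq_norm n x \<partial>std_gaussian n) / s\<^sup>2"
    using s by (intro integral_Markov_inequality_measure[where A="{}"] integrable_sq_norm) auto
  also have "(\<integral>x. sq_norm n x \<partial>std_gaussian n) = real n"
    by (rule integral_sq_norm)
  finally show ?thesis .
qed

text \<open>Among the factors 1, 5, 9, ... let \<open>j\<close> index the first dilate of volume at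
  least \<open>2 / 3\<close>. The one before is below \<open>2 / 3\<close>, and by concentration the
  one after is at least \<open>5 / 6\<close>. So \<open>ln (5 / 4) >= 1 / 5\<close> is gained over
  the length 8, wherever this happens; the slope at 1 is at least as large. This is the weakest of
  the three cases and the origin of the constant 40.\<close>

lemma deficit_fat:
  assumes ball: "\<And>a. a \<in> space (lebesgue_n n) \<Longrightarrow> sq_norm n a \<le> 1 \<Longrightarrow> a \<in> K"
    and vol: "gauss_vol n K < 2 / 3"
  shows "1 / 40 \<le> real n - mean_sq"
proof -
  have "\<exists>j::nat. 2 / 3 \<le> vol_dilate (1 + 4 * real j)"
  proof -
    obtain j :: nat where j: "3 * real n < j" using reals_Archimedean2 by blast
    have "real j * 1 \<le> (1 + 4 * real j) * (1 + 4 * real j)" by (intro mult_mono) auto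
    then have "3 * real n \<le> (1 + 4 * real j)\<^sup>2" using j unfolding power2_eq_square by linarith
    then have "real n / (1 + 4 * real j)\<^sup>2 \<le> 1 / 3" by (simp add: field_simps)
    then show ?thesis
      using vol_dilate_ge_Markov[OF ball, of "1 + 4 * real j"] by (intro exI[of _ j]) linarith
  qed
  define j where "j = (LEAST j::nat. 2 / 3 \<le> vol_dilate (1 + 4 * real j))"
  have j: "2 / 3 \<le> vol_dilate (1 + 4 * real j)"
    unfolding j_def by (rule LeastI_ex) fact
  have "j \<noteq> 0" using j vol vol_dilate_1 by (intro notI) simp
  then obtain i where i: "j = Suc i" by (cases j) auto
  have lo: "vol_dilate (1 + 4 * real i) < 2 / 3"
    using not_less_Least[of i "\<lambda>j. 2 / 3 \<le> vol_dilate (1 + 4 * real j)"] unfolding j_def[symmetric] i by simp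
  define p where "p = vol_dilate (1 + 4 * real j + 4)"
  have p1: "p \<le> 1" by (simp add: p_def)
  have "2 / 3 * (1 - p) \<le> vol_dilate (1 + 4 * real j) * (1 - p)"
    using j p1 by (intro mult_right_mono) auto
  also have "\<dots> \<le> exp (- 4)"
    unfolding p_def by (rule concentration[OF ball]) auto
  also have "\<dots> \<le> 1 / 9"
  proof -
    have "(3::real)\<^sup>2 \<le> (exp 2)\<^sup>2" using exp_ge_add_one_self[of 2] by (intro power_mono) auto
    also have "\<dots> = exp (4::real)" by (simp add: exp_double[symmetric])
    finally show ?thesis by (simp add: exp_minus field_simps)
  qed
  finally have p: "5 / 6 \<le> p" by simp
  have "ln (5 / 6) - ln (2 / 3) \<le> ln p - ln (vol_dilate (1 + 4 * real i))"
    using p lo vol_dilate_pos[of "1 + 4 * real i"] by (intro diff_mono ln_mono) auto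
  also have "\<dots> \<le> 8 * (real n - mean_sq)"
    using ln_vol_dilate_slope[of "1 + 4 * i" "1 + 4 * j + 4"] by (simp add: p_def i algebra_simps)
  finally have "ln (5 / 6) - ln (2 / 3) \<le> 8 * (real n - mean_sq)" .
  moreover have "ln (4 / 5 :: real) \<le> 4 / 5 - 1" by (intro ln_le_minus_one) auto
  moreover have "ln (4 / 5 :: real) = ln (2 / 3) - ln (5 / 6)" using ln_div[of "2 / 3 :: real" "5 / 6"] by simp
  ultimately show ?thesis by simp
qed

theorem mean_sq_deficit: "(1 - gauss_vol n K) / 40 \<le> real n - mean_sq"
proof -
  consider "2 / 3 \<le> gauss_vol n K"
    | a where "a \<in> space (lebesgue_n n)" "a \<notin> K" "sq_norm n a \<le> 1"
    | "gauss_vol n K < 2 / 3" "\<And>a. a \<in> space (lebesgue_n n) \<Longrightarrow> sq_norm n a \<le> 1 \<Longrightarrow> a \<in> K"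
    by (meson not_le)
  then show ?thesis
  proof cases
    case 1
    then show ?thesis using deficit_large_volume vol_le_1 by simp
  next
    case 2
    then show ?thesis using deficit_thin[of a] vol_pos by simp
  next
    case 3
    then show ?thesis using deficit_fat vol_pos by simp
  qed
qed

end

subsection \<open>Moments of the truncated Gaussian\<close>

lemma sets_truncated_gaussian [simp, measurable_cong]:
  "sets (truncated_gaussian n K) = sets (lebesgue_n n)"
  by (simp add: truncated_gaussian_def)

lemma space_truncated_gaussian [simp]: "space (truncated_gaussian n K) = space (lebesgue_n n)"
  by (simp add: truncated_gaussian_def)

context symm_convex_set
begin

lemma nn_integral_truncated_gaussian:
  fixes f :: "point \<Rightarrow> ennreal"
  assumes [measurable]: "f \<in> borel_measurable (lebesgue_n n)"
  shows "(\<integral>\<^sup>+x. f x \<partial>truncated_gaussian n K)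
    = ennreal (1 / gauss_vol n K) * (\<integral>\<^sup>+x. f x * indicator K x \<partial>std_gaussian n)"
proof -
  have "(\<integral>\<^sup>+x. f x \<partial>truncated_gaussian n K)
      = (\<integral>\<^sup>+x. ennreal (gauss_density n x * indicator K x / gauss_vol n K) * f x \<partial>lebesgue_n n)"
    unfolding truncated_gaussian_def by (rule nn_integral_density) auto
  also have "\<dots> = (\<integral>\<^sup>+x. ennreal (1 / gauss_vol n K) * (ennreal (gauss_density n x) * (f x * indicator K x)) \<partial>lebesgue_n n)"
  proof (intro nn_integral_cong)
    fix x
    have "ennreal (gauss_density n x / gauss_vol n K) = ennreal (1 / gauss_vol n K) * ennreal (gauss_density n x)"
      using vol_pos by (subst ennreal_mult'[symmetric]) auto
    then show "ennreal (gauss_density n x * indicator K x / gauss_vol n K) * f x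
        = ennreal (1 / gauss_vol n K) * (ennreal (gauss_density n x) * (f x * indicator K x))"
      by (auto simp: indicator_def mult.assoc)
  qed
  also have "\<dots> = ennreal (1 / gauss_vol n K) * (\<integral>\<^sup>+x. ennreal (gauss_density n x) * (f x * indicator K x) \<partial>lebesgue_n n)"
    by (rule nn_integral_cmult) measurable
  also have "(\<integral>\<^sup>+x. ennreal (gauss_density n x) * (f x * indicator K x) \<partial>lebesgue_n n)
      = (\<integral>\<^sup>+x. f x * indicator K x \<partial>std_gaussian n)"
    by (rule nn_integral_std_gaussian[symmetric]) measurable
  finally show ?thesis .
qed

lemma measure_truncated_gaussian:
  assumes [measurable]: "A \<in> sets (lebesgue_n n)"
  shows "measure (truncated_gaussian n K) A = measure (std_gaussian n) (A \<inter> K) / gauss_vol n K"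
    and "emeasure (truncated_gaussian n K) A = ennreal (measure (std_gaussian n) (A \<inter> K) / gauss_vol n K)"
proof -
  have "emeasure (truncated_gaussian n K) A = (\<integral>\<^sup>+x. indicator A x \<partial>truncated_gaussian n K)"
    by simp
  also have "\<dots> = ennreal (1 / gauss_vol n K) * (\<integral>\<^sup>+x. indicator A x * indicator K x \<partial>std_gaussian n)"
    by (rule nn_integral_truncated_gaussian) measurable
  also have "(\<lambda>x. indicator A x * indicator K x) = (indicator (A \<inter> K) :: point \<Rightarrow> ennreal)"
    by (auto simp: indicator_def)
  also have "(\<integral>\<^sup>+x. indicator (A \<inter> K) x \<partial>std_gaussian n) = ennreal (measure (std_gaussian n) (A \<inter> K))"
    by (subst nn_integral_indicator) (auto simp: std_gaussian.emeasure_eq_measure)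
  finally show "emeasure (truncated_gaussian n K) A = ennreal (measure (std_gaussian n) (A \<inter> K) / gauss_vol n K)"
    using vol_pos by (simp add: ennreal_mult'[symmetric])
  then show "measure (truncated_gaussian n K) A = measure (std_gaussian n) (A \<inter> K) / gauss_vol n K"
    using vol_pos by (simp add: measure_def)
qed

lemma prob_space_truncated_gaussian: "prob_space (truncated_gaussian n K)"
proof (rule prob_spaceI)
  have "space (lebesgue_n n) \<inter> K = K" using K_space by auto
  then show "emeasure (truncated_gaussian n K) (space (truncated_gaussian n K)) = 1"
    using vol_pos by (simp add: measure_truncated_gaussian(2)) (simp add: gauss_vol_def)
qed

lemma measure_truncated_gaussian_space: "measure (truncated_gaussian n K) (space (lebesgue_n n)) = 1"
  using prob_space.prob_space[OF prob_space_truncated_gaussian] by simp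

text \<open>The signed difference is \<open>q / p - q\<close> minus the mass of
  \<open>A - K\<close>, and both of these numbers lie between 0 and \<open>1 - p\<close>.\<close>

lemma truncated_gaussian_close:
  assumes [measurable]: "A \<in> sets (lebesgue_n n)"
  shows "\<bar>measure (truncated_gaussian n K) A - measure (std_gaussian n) A\<bar> \<le> 1 - gauss_vol n K"
proof -
  define p q where "p = gauss_vol n K" and "q = measure (std_gaussian n) (A \<inter> K)"
  have p: "0 < p" "p \<le> 1" using vol_pos vol_le_1 by (auto simp: p_def)
  have q: "0 \<le> q" "q \<le> p"
    by (auto simp: p_def q_def gauss_vol_def intro!: std_gaussian.finite_measure_mono)
  have split: "measure (std_gaussian n) A = q + measure (std_gaussian n) (A - K)"
    unfolding q_def by (subst std_gaussian.finite_measure_Union[symmetric]) (auto intro!: arg_cong[where f="measure _"])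
  have "measure (std_gaussian n) (A - K) \<le> measure (std_gaussian n) (space (std_gaussian n) - K)"
    using sets.sets_into_space[OF assms] by (intro std_gaussian.finite_measure_mono) auto
  also have "\<dots> = 1 - p"
    using std_gaussian.prob_compl[of K n] by (auto simp: p_def gauss_vol_def)
  finally have r: "measure (std_gaussian n) (A - K) \<le> 1 - p" .
  have "q / p - q = q / p * (1 - p)" using p by (simp add: right_diff_distrib)
  also have "\<dots> \<le> 1 * (1 - p)" using p q by (intro mult_right_mono) auto
  finally have "q / p - q \<le> 1 - p" by simp
  moreover have "q \<le> q / p" using p q mult_right_mono[of p 1 q] by (simp add: field_simps)
  moreover have "0 \<le> measure (std_gaussian n) (A - K)" by simp
  ultimately show ?thesis
    unfolding measure_truncated_gaussian(1)[OF assms] q_def[symmetric] p_def[symmetric] split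
    using r by linarith
qed

lemma nn_integral_sq_norm_truncated: "(\<integral>\<^sup>+x. sq_norm n x \<partial>truncated_gaussian n K) = ennreal mean_sq"
proof -
  have "(\<integral>\<^sup>+x. ennreal (sq_norm n x) * indicator K x \<partial>std_gaussian n)
      = (\<integral>\<^sup>+x. ennreal (sq_norm n x * indicator K x) \<partial>std_gaussian n)"
    by (intro nn_integral_cong) (auto simp: indicator_def)
  also have "\<dots> = ennreal (mean_sq * gauss_vol n K)"
    using vol_pos by (subst nn_integral_eq_integral[OF integrable_sq_norm_K]) (auto simp: mean_sq_def)
  finally show ?thesis
    using vol_pos mean_sq_nonneg
    by (subst nn_integral_truncated_gaussian) (auto simp: ennreal_mult'[symmetric])
qed

lemma integrable_sq_norm_truncated: "integrable (truncated_gaussian n K) (sq_norm n)"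
  by (rule integrableI_nonneg) (auto simp: nn_integral_sq_norm_truncated)

lemma integral_sq_norm_truncated: "(\<integral>x. sq_norm n x \<partial>truncated_gaussian n K) = mean_sq"
  using nn_integral_eq_integral[OF integrable_sq_norm_truncated] nn_integral_sq_norm_truncated mean_sq_nonneg
  by (simp add: integral_nonneg)

lemma mean_sq_le: "mean_sq \<le> real n"
  using mean_sq_deficit vol_le_1 by simp

section \<open>Variance of the squared norm under the truncated Gaussian\<close>

text \<open>Maurey's property \<open>(\<tau>)\<close> for the quadratic function \<open>a * sq_norm n y\<close>, whose infimal convolution
  with a quarter of the squared distance is \<open>a / (1 + 4 * a) * sq_norm n x\<close>.\<close>
lemma maurey_quadratic:
  assumes a: "0 < a" and b: "b = a / (1 + 4 * a)"
  shows "(\<integral>\<^sup>+x. exp (b * sq_norm n x) \<partial>truncated_gaussian n K) *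
    (\<integral>\<^sup>+x. exp (- a * sq_norm n x) \<partial>truncated_gaussian n K) \<le> 1"
proof -
  have coord: "b * s\<^sup>2 \<le> a * u\<^sup>2 + (s - u)\<^sup>2 / 4" for s u :: real
  proof -
    have "(a * u\<^sup>2 + (s - u)\<^sup>2 / 4) * (1 + 4 * a) - a * s\<^sup>2 = (s - (1 + 4 * a) * u)\<^sup>2 / 4"
      by (simp add: power2_eq_square field_simps)
    then have "a * s\<^sup>2 \<le> (a * u\<^sup>2 + (s - u)\<^sup>2 / 4) * (1 + 4 * a)"
      by (metis diff_ge_0_iff_ge zero_le_divide_iff zero_le_numeral zero_le_power2)
    then show ?thesis using a unfolding b by (simp add: pos_divide_le_eq)
  qed
  have sq: "b * sq_norm n x - a * sq_norm n y \<le> sq_norm n (\<lambda>i. x i - y i) / 4" for x y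
  proof -
    have "b * sq_norm n x \<le> (\<Sum>i<n. a * (y i)\<^sup>2 + (x i - y i)\<^sup>2 / 4)"
      unfolding sq_norm_def sum_distrib_left by (intro sum_mono coord)
    also have "\<dots> = a * sq_norm n y + sq_norm n (\<lambda>i. x i - y i) / 4"
      by (simp add: sq_norm_def sum.distrib sum_distrib_left sum_divide_distrib)
    finally show ?thesis by simp
  qed
  let ?P = "\<integral>\<^sup>+x. exp (b * sq_norm n x) * indicator K x \<partial>std_gaussian n"
  let ?R = "\<integral>\<^sup>+x. exp (- a * sq_norm n x) * indicator K x \<partial>std_gaussian n"
  have "?P * ?R \<le> (\<integral>\<^sup>+x. indicator K x \<partial>std_gaussian n)\<^sup>2"
  proof (rule prekopa_leindler_gaussian)
    fix x y assume xy: "x \<in> space (lebesgue_n n)" "y \<in> space (lebesgue_n n)"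
    show "ennreal (exp (b * sq_norm n x) * indicator K x) * ennreal (exp (- a * sq_norm n y) * indicator K y)
        \<le> (indicator K (mid_point x y))\<^sup>2 * ennreal (exp (sq_norm n (\<lambda>i. x i - y i) / 4))"
    proof (cases "x \<in> K \<and> y \<in> K")
      case True
      have "mid_point x y \<in> K"
        by (rule K_convex[of x y "1 / 2" "1 / 2"]) (use True xy in \<open>auto simp: mid_point_def space_lebesgue_n PiE_def extensional_def\<close>)
      then show ?thesis
        using True sq[of x y] by (simp add: ennreal_mult'[symmetric] exp_add[symmetric])
    qed auto
  qed measurable
  then have PR: "?P * ?R \<le> ennreal ((gauss_vol n K)\<^sup>2)"
    by (simp add: std_gaussian.emeasure_eq_measure gauss_vol_def ennreal_power)
  have "(\<integral>\<^sup>+x. exp (b * sq_norm n x) \<partial>truncated_gaussian n K) *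
      (\<integral>\<^sup>+x. exp (- a * sq_norm n x) \<partial>truncated_gaussian n K)
    = (ennreal (1 / gauss_vol n K) * ?P) * (ennreal (1 / gauss_vol n K) * ?R)"
    by (subst (1 2) nn_integral_truncated_gaussian)
      (auto intro!: arg_cong2[where f="(*)"] nn_integral_cong simp: indicator_def)
  also have "\<dots> = ennreal ((1 / gauss_vol n K)\<^sup>2) * (?P * ?R)"
  proof -
    have "ennreal ((1 / gauss_vol n K)\<^sup>2) = ennreal (1 / gauss_vol n K) * ennreal (1 / gauss_vol n K)"
      using vol_pos unfolding power2_eq_square by (intro ennreal_mult) auto
    then show ?thesis by (simp only: mult_ac)
  qed
  also have "\<dots> \<le> ennreal ((1 / gauss_vol n K)\<^sup>2) * ennreal ((gauss_vol n K)\<^sup>2)"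
    by (intro mult_left_mono PR) simp
  also have "\<dots> = 1"
    using vol_pos by (simp add: ennreal_mult'[symmetric] power_mult_distrib[symmetric])
  finally show ?thesis .
qed

text \<open>Centred at the mean, Maurey's inequality bounds the product of the exponential moments
  \<open>P\<close> and \<open>R\<close> by \<open>exp ((a - b) * mean_sq)\<close>. Both are at least
  1 by Jensen, so a bound on the product bounds each, and a second-order lower bound on
  \<open>exp\<close> extracts the variance.\<close>

lemma variance_sq_norm_truncated:
  assumes n: "1 \<le> n"
  shows "integrable (truncated_gaussian n K) (\<lambda>x. (sq_norm n x - mean_sq)\<^sup>2)"
    and "(\<integral>x. (sq_norm n x - mean_sq)\<^sup>2 \<partial>truncated_gaussian n K) \<le> 64 * real n"
proof -
  interpret T: prob_space "truncated_gaussian n K" by (rule prob_space_truncated_gaussian)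
  let ?Y = "sq_norm n" and ?m = mean_sq
  \<comment> \<open>\<open>a\<close> solves \<open>b = a / (1 + 4 * a)\<close>. The size of
    \<open>b\<close> makes \<open>(a - b) * mean_sq\<close> at most a constant and
    \<open>1 / b\<^sup>2\<close> equal to \<open>64 * n\<close>.\<close>
  define b a where "b = 1 / (8 * sqrt (real n))" and "a = b / (1 - 4 * b)"
  have b: "0 < b" "b \<le> 1 / 8" "b\<^sup>2 * real n = 1 / 64"
    using n by (auto simp: b_def power_divide power_mult_distrib)
  have a: "b \<le> a" "a \<le> 2 * b" "0 < a" "b = a / (1 + 4 * a)"
    using b by (auto simp: a_def field_simps)
  have [measurable]: "?Y \<in> borel_measurable (truncated_gaussian n K)"
    by measurable
  have intR: "integrable (truncated_gaussian n K) (\<lambda>x. exp (- a * ?Y x))"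
    using a by (intro T.integrable_const_bound[of _ 1]) auto
  \<comment> \<open>Jensen, through the tangent of \<open>exp\<close>. A positive second factor is
    what forces the exponential moment with parameter \<open>b\<close> to be finite, because the
    product is at most 1.\<close>
  have Rpos: "0 < (\<integral>x. exp (- a * ?Y x) \<partial>truncated_gaussian n K)"
  proof -
    have "exp (- a * ?m) * (1 + a * ?m) - exp (- a * ?m) * a * ?m
        = (\<integral>x. exp (- a * ?m) * (1 + a * ?m) - exp (- a * ?m) * a * ?Y x \<partial>truncated_gaussian n K)"
      by (simp add: integrable_sq_norm_truncated integral_sq_norm_truncated measure_truncated_gaussian_space)
    also have "\<dots> \<le> (\<integral>x. exp (- a * ?Y x) \<partial>truncated_gaussian n K)"
    proof (intro integral_mono)
      fix x
      have "exp (- a * ?m) * (1 + (a * ?m - a * ?Y x)) \<le> exp (- a * ?m) * exp (a * ?m - a * ?Y x)"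
        by (intro mult_left_mono exp_ge_add_one_self) auto
      then show "exp (- a * ?m) * (1 + a * ?m) - exp (- a * ?m) * a * ?Y x \<le> exp (- a * ?Y x)"
        by (simp add: exp_add[symmetric] algebra_simps)
    qed (use intR integrable_sq_norm_truncated in auto)
    finally have "exp (- a * ?m) \<le> (\<integral>x. exp (- a * ?Y x) \<partial>truncated_gaussian n K)"
      by (simp add: algebra_simps)
    then show ?thesis by (rule less_le_trans[rotated]) simp
  qed
  have nnR: "(\<integral>\<^sup>+x. exp (- a * ?Y x) \<partial>truncated_gaussian n K)
      = ennreal (\<integral>x. exp (- a * ?Y x) \<partial>truncated_gaussian n K)"
    by (rule nn_integral_eq_integral[OF intR]) simp
  note PR = maurey_quadratic[OF a(3,4)]
  have "(\<integral>\<^sup>+x. exp (b * ?Y x) \<partial>truncated_gaussian n K) < \<infinity>"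
  proof (rule ccontr)
    assume "\<not> ?thesis"
    then have "(\<integral>\<^sup>+x. exp (b * ?Y x) \<partial>truncated_gaussian n K) = \<top>" by (simp add: not_less top_unique)
    then show False using PR Rpos unfolding nnR by (simp add: ennreal_top_mult top_unique)
  qed
  then have intP: "integrable (truncated_gaussian n K) (\<lambda>x. exp (b * ?Y x))"
    by (intro integrableI_nonneg) auto
  define P R where "P = (\<integral>x. exp (b * (?Y x - ?m)) \<partial>truncated_gaussian n K)"
    and "R = (\<integral>x. exp (- a * (?Y x - ?m)) \<partial>truncated_gaussian n K)"
  have P_eq: "exp (b * (?Y x - ?m)) = exp (- b * ?m) * exp (b * ?Y x)"
    and R_eq: "exp (- a * (?Y x - ?m)) = exp (a * ?m) * exp (- a * ?Y x)" for x
    by (simp_all add: exp_add[symmetric] algebra_simps)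
  have intP': "integrable (truncated_gaussian n K) (\<lambda>x. exp (b * (?Y x - ?m)))"
    unfolding P_eq using intP by simp
  have intR': "integrable (truncated_gaussian n K) (\<lambda>x. exp (- a * (?Y x - ?m)))"
    unfolding R_eq using intR by simp
  have intY: "integrable (truncated_gaussian n K) (\<lambda>x. t * (?Y x - ?m))" for t
    using integrable_sq_norm_truncated by simp
  have EY: "(\<integral>x. t * (?Y x - ?m) \<partial>truncated_gaussian n K) = 0" for t
    by (simp add: integrable_sq_norm_truncated integral_sq_norm_truncated measure_truncated_gaussian_space)
  have ge1: "1 \<le> (\<integral>x. exp (t * (?Y x - ?m)) \<partial>truncated_gaussian n K)"
    if "integrable (truncated_gaussian n K) (\<lambda>x. exp (t * (?Y x - ?m)))" for t
  proof -
    have "1 = (\<integral>x. 1 + t * (?Y x - ?m) \<partial>truncated_gaussian n K)"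
      by (subst Bochner_Integration.integral_add) (use intY EY in \<open>auto simp: measure_truncated_gaussian_space\<close>)
    also have "\<dots> \<le> (\<integral>x. exp (t * (?Y x - ?m)) \<partial>truncated_gaussian n K)"
      by (intro integral_mono that exp_ge_add_one_self) (use intY in auto)
    finally show ?thesis .
  qed
  have P1: "1 \<le> P" and R1: "1 \<le> R"
    unfolding P_def R_def by (intro ge1 intP' intR')+
  define p r where "p = (\<integral>x. exp (b * ?Y x) \<partial>truncated_gaussian n K)"
    and "r = (\<integral>x. exp (- a * ?Y x) \<partial>truncated_gaussian n K)"
  have "ennreal p * ennreal r \<le> 1"
    using PR nnR nn_integral_eq_integral[OF intP] by (simp add: p_def r_def)
  then have "p * r \<le> 1"
    by (subst (asm) ennreal_mult'[symmetric]) (auto simp: p_def r_def)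
  then have "exp ((a - b) * ?m) * (p * r) \<le> exp ((a - b) * ?m)"
    by (intro mult_left_le) auto
  moreover have "P = exp (- b * ?m) * p" "R = exp (a * ?m) * r"
    unfolding P_def R_def P_eq R_eq p_def r_def by simp_all
  then have "P * R = exp (- b * ?m) * exp (a * ?m) * (p * r)" by simp
  then have "P * R = exp ((a - b) * ?m) * (p * r)"
    unfolding exp_add[symmetric] by (simp add: algebra_simps)
  ultimately have PR': "P * R \<le> exp ((a - b) * ?m)" by simp
  \<comment> \<open>Here \<open>mean_sq <= n\<close> enters, itself a consequence of the deficit
    bound.\<close>
  have ab: "(a - b) * ?m \<le> 1 / 8"
  proof -
    have "a - b = 4 * b * a" using b by (simp add: a_def field_simps)
    also have "\<dots> \<le> 4 * b * (2 * b)" using a b by (intro mult_left_mono) auto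
    finally have "(a - b) * ?m \<le> (8 * b\<^sup>2) * real n"
      using a mean_sq_nonneg mean_sq_le by (intro mult_mono) (auto simp: power2_eq_square)
    then show ?thesis using b(3) by simp
  qed
  note PR'
  also have "exp ((a - b) * ?m) \<le> exp (1 / 8)" using ab by simp
  also have "exp (1 / 8 :: real) \<le> 5 / 4"
    using exp_bound[of "1 / 8"] by (simp add: power2_eq_square)
  finally have PR5: "P * R \<le> 5 / 4" .
  have "P \<le> P * R" "R \<le> P * R" using P1 R1 by (simp_all add: mult_le_cancel_left1 mult_le_cancel_right1)
  then have PR4: "P + R - 2 \<le> 1 / 2" using PR5 by simp
  \<comment> \<open>The quadratic term comes from \<open>exp (b * z)\<close> for
    \<open>z >= 0\<close> and from \<open>exp (- a * z)\<close> for \<open>z < 0\<close>; the other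
    exponential is bounded by its tangent. The leftover linear term has mean 0.\<close>
  have pt: "b\<^sup>2 / 2 * (?Y x - ?m)\<^sup>2 \<le> (exp (b * (?Y x - ?m)) + exp (- a * (?Y x - ?m)) - 2) + (a - b) * (?Y x - ?m)" for x
  proof -
    define z where "z = ?Y x - ?m"
    have 1: "1 + b * z \<le> exp (b * z)" "1 - a * z \<le> exp (- a * z)"
      using exp_ge_add_one_self[of "b * z"] exp_ge_add_one_self[of "- a * z"] by auto
    show ?thesis
    proof (cases "0 \<le> z")
      case True
      then have "1 + b * z + (b * z)\<^sup>2 / 2 \<le> exp (b * z)"
        using b by (intro exp_lower_Taylor_quadratic) auto
      with 1 show ?thesis unfolding z_def[symmetric] by (simp add: power_mult_distrib algebra_simps)
    next
      case False
      have "1 + (- a * z) + (- a * z)\<^sup>2 / 2 \<le> exp (- a * z)"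
        using a False by (intro exp_lower_Taylor_quadratic) (auto simp: mult_nonneg_nonpos)
      moreover have "b\<^sup>2 * z\<^sup>2 \<le> a\<^sup>2 * z\<^sup>2" using a b by (intro mult_right_mono power_mono) auto
      moreover have "(- a * z)\<^sup>2 = a\<^sup>2 * z\<^sup>2" by (simp add: power_mult_distrib)
      ultimately show ?thesis
        using 1 unfolding z_def[symmetric] left_diff_distrib by linarith
    qed
  qed
  have int_dom: "integrable (truncated_gaussian n K)
      (\<lambda>x. (exp (b * (?Y x - ?m)) + exp (- a * (?Y x - ?m)) - 2) + (a - b) * (?Y x - ?m))"
    by (intro Bochner_Integration.integrable_add Bochner_Integration.integrable_diff intP' intR' intY) simp
  have "integrable (truncated_gaussian n K) (\<lambda>x. b\<^sup>2 / 2 * (?Y x - ?m)\<^sup>2)"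
  proof (rule Bochner_Integration.integrable_bound[OF int_dom])
    show "AE x in truncated_gaussian n K. norm (b\<^sup>2 / 2 * (?Y x - ?m)\<^sup>2)
        \<le> norm ((exp (b * (?Y x - ?m)) + exp (- a * (?Y x - ?m)) - 2) + (a - b) * (?Y x - ?m))"
    proof (intro AE_I2)
      fix x
      have "0 \<le> b\<^sup>2 / 2 * (?Y x - ?m)\<^sup>2" by simp
      then show "norm (b\<^sup>2 / 2 * (?Y x - ?m)\<^sup>2)
          \<le> norm ((exp (b * (?Y x - ?m)) + exp (- a * (?Y x - ?m)) - 2) + (a - b) * (?Y x - ?m))"
        using order.trans[OF pt[of x] abs_ge_self] by (simp only: real_norm_def abs_of_nonneg)
    qed
  qed measurable
  then have "integrable (truncated_gaussian n K) (\<lambda>x. 2 / b\<^sup>2 * (b\<^sup>2 / 2 * (?Y x - ?m)\<^sup>2))"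
    by (rule integrable_mult_right)
  then show int: "integrable (truncated_gaussian n K) (\<lambda>x. (?Y x - ?m)\<^sup>2)"
    using b by simp
  have "b\<^sup>2 / 2 * (\<integral>x. (?Y x - ?m)\<^sup>2 \<partial>truncated_gaussian n K)
      = (\<integral>x. b\<^sup>2 / 2 * (?Y x - ?m)\<^sup>2 \<partial>truncated_gaussian n K)"
    by simp
  also have "\<dots> \<le> (\<integral>x. (exp (b * (?Y x - ?m)) + exp (- a * (?Y x - ?m)) - 2) + (a - b) * (?Y x - ?m) \<partial>truncated_gaussian n K)"
    using int by (intro integral_mono int_dom pt) auto
  also have "\<dots> = P + R - 2"
    using EY[of "a - b"] intY[of "a - b"] intP' intR' by (simp add: P_def R_def measure_truncated_gaussian_space)
  finally have "b\<^sup>2 * (\<integral>x. (?Y x - ?m)\<^sup>2 \<partial>truncated_gaussian n K) \<le> 1" using PR4 by simp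
  then have "(b\<^sup>2 * real n) * (\<integral>x. (?Y x - ?m)\<^sup>2 \<partial>truncated_gaussian n K) \<le> real n"
    using mult_left_mono[of "b\<^sup>2 * (\<integral>x. (?Y x - ?m)\<^sup>2 \<partial>truncated_gaussian n K)" 1 "real n"] by (simp add: mult_ac)
  then show "(\<integral>x. (?Y x - ?m)\<^sup>2 \<partial>truncated_gaussian n K) \<le> 64 * real n"
    unfolding b(3) by simp
qed

text \<open>Centring at \<open>n\<close>, which is common to all components, makes the bound fit for
  averaging over a mixture. The squared bias is at most \<open>n * (n - mean_sq)\<close> because the
  deficit lies between 0 and \<open>n\<close>, so the bound stays affine in
  \<open>mean_sq\<close>.\<close>

lemma second_moment_about_dimension:
  assumes n: "1 \<le> n"
  shows "(\<integral>\<^sup>+x. ennreal ((sq_norm n x - real n)\<^sup>2) \<partial>truncated_gaussian n K)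
    \<le> ennreal (64 * real n + real n * (real n - mean_sq))"
proof -
  interpret T: prob_space "truncated_gaussian n K" by (rule prob_space_truncated_gaussian)
  define d where "d = real n - mean_sq"
  have d: "0 \<le> d" "d \<le> real n" using mean_sq_nonneg mean_sq_le by (auto simp: d_def)
  have eq: "(sq_norm n x - real n)\<^sup>2 = (sq_norm n x - mean_sq)\<^sup>2 + ((- 2 * d) * (sq_norm n x - mean_sq) + d\<^sup>2)" for x
    by (simp add: d_def power2_eq_square algebra_simps)
  note int = variance_sq_norm_truncated(1)[OF n]
  have int': "integrable (truncated_gaussian n K) (\<lambda>x. (- 2 * d) * (sq_norm n x - mean_sq) + d\<^sup>2)"
    using integrable_sq_norm_truncated by simp
  have int'': "integrable (truncated_gaussian n K) (\<lambda>x. (sq_norm n x - real n)\<^sup>2)"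
    unfolding eq by (rule Bochner_Integration.integrable_add[OF int int'])
  have "(\<integral>\<^sup>+x. ennreal ((sq_norm n x - real n)\<^sup>2) \<partial>truncated_gaussian n K)
      = ennreal (\<integral>x. (sq_norm n x - real n)\<^sup>2 \<partial>truncated_gaussian n K)"
    by (rule nn_integral_eq_integral[OF int'']) simp
  also have "(\<integral>x. (sq_norm n x - real n)\<^sup>2 \<partial>truncated_gaussian n K)
      = (\<integral>x. (sq_norm n x - mean_sq)\<^sup>2 \<partial>truncated_gaussian n K) + d\<^sup>2"
    unfolding eq by (subst Bochner_Integration.integral_add[OF int int'])
      (simp add: integrable_sq_norm_truncated integral_sq_norm_truncated measure_truncated_gaussian_space)
  also have "\<dots> \<le> 64 * real n + real n * d"
    using variance_sq_norm_truncated(2)[OF n] d by (intro add_mono) (auto simp: power2_eq_square mult_right_mono)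
  finally show ?thesis by (simp add: d_def ennreal_leI)
qed

end

subsection \<open>Empirical means\<close>

lemma (in prob_space) integral_PiM_square_sum:
  fixes X :: "'a \<Rightarrow> real" and T :: nat
  assumes X: "integrable M X" "integrable M (\<lambda>x. (X x)\<^sup>2)" and mean: "expectation X = 0"
  shows "integrable (Pi\<^sub>M {..<T} (\<lambda>_. M)) (\<lambda>w. (\<Sum>i<T. X (w i))\<^sup>2)"
    and "(\<integral>w. (\<Sum>i<T. X (w i))\<^sup>2 \<partial>Pi\<^sub>M {..<T} (\<lambda>_. M)) = real T * expectation (\<lambda>x. (X x)\<^sup>2)"
proof -
  interpret P: product_sigma_finite "\<lambda>_::nat. M" by unfold_locales
  let ?P = "Pi\<^sub>M {..<T} (\<lambda>_. M)"
  have pair: "integrable ?P (\<lambda>w. X (w i) * X (w j)) \<and>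
      (\<integral>w. X (w i) * X (w j) \<partial>?P) = (if i = j then expectation (\<lambda>x. (X x)\<^sup>2) else 0)"
    if ij: "i < T" "j < T" for i j
  proof -
    \<comment> \<open>Writes \<open>X (w i) * X (w j)\<close> as a product with one factor per
      coordinate, so that independence applies; on the diagonal a single factor carries the
      square.\<close>
    define f where "f k = (if k = i \<and> k = j then (\<lambda>x. (X x)\<^sup>2) else if k = i \<or> k = j then X else (\<lambda>_. 1))" for k
    have int: "integrable M (f k)" for k using X by (auto simp: f_def)
    have prod: "(\<Prod>k<T. f k (w k)) = X (w i) * X (w j)" for w
    proof -
      have "(\<Prod>k<T. f k (w k)) = (\<Prod>k\<in>{i, j}. f k (w k))"
        using ij by (intro prod.mono_neutral_right) (auto simp: f_def)
      then show ?thesis by (cases "i = j") (auto simp: f_def power2_eq_square)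
    qed
    have "(\<Prod>k<T. expectation (f k)) = (\<Prod>k\<in>{i, j}. expectation (f k))"
      using ij by (intro prod.mono_neutral_right) (auto simp: f_def prob_space)
    also have "\<dots> = (if i = j then expectation (\<lambda>x. (X x)\<^sup>2) else 0)"
      by (cases "i = j") (auto simp: f_def mean)
    finally show ?thesis
      using P.product_integrable_prod[of "{..<T}" f] P.product_integral_prod[of "{..<T}" f] int
      by (simp add: prod)
  qed
  have eq: "(\<Sum>i<T. X (w i))\<^sup>2 = (\<Sum>i<T. \<Sum>j<T. X (w i) * X (w j))" for w
    by (simp add: power2_eq_square sum_product)
  show "integrable ?P (\<lambda>w. (\<Sum>i<T. X (w i))\<^sup>2)"
    unfolding eq using pair by (intro Bochner_Integration.integrable_sum) auto
  have "(\<integral>w. (\<Sum>i<T. X (w i))\<^sup>2 \<partial>?P) = (\<Sum>i<T. \<Sum>j<T. \<integral>w. X (w i) * X (w j) \<partial>?P)"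
    unfolding eq using pair
    by (subst Bochner_Integration.integral_sum, force intro!: Bochner_Integration.integrable_sum)
      (auto intro!: sum.cong Bochner_Integration.integral_sum)
  also have "\<dots> = (\<Sum>i<T. \<Sum>j<T. if i = j then expectation (\<lambda>x. (X x)\<^sup>2) else 0)"
    using pair by (intro sum.cong) auto
  also have "\<dots> = real T * expectation (\<lambda>x. (X x)\<^sup>2)" by simp
  finally show "(\<integral>w. (\<Sum>i<T. X (w i))\<^sup>2 \<partial>?P) = real T * expectation (\<lambda>x. (X x)\<^sup>2)" .
qed

lemma (in prob_space) Chebyshev_empirical_mean:
  fixes Y :: "'a \<Rightarrow> real" and T :: nat
  assumes Y: "integrable M Y" "integrable M (\<lambda>x. (Y x - expectation Y)\<^sup>2)" and T: "0 < T" and \<delta>: "0 < \<delta>"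
  shows "measure (Pi\<^sub>M {..<T} (\<lambda>_. M))
      {w \<in> space (Pi\<^sub>M {..<T} (\<lambda>_. M)). \<delta> \<le> \<bar>(1 / real T) * (\<Sum>i<T. Y (w i)) - expectation Y\<bar>}
    \<le> expectation (\<lambda>x. (Y x - expectation Y)\<^sup>2) / (real T * \<delta>\<^sup>2)"
proof -
  let ?P = "Pi\<^sub>M {..<T} (\<lambda>_. M)"
  define X where "X = (\<lambda>x. Y x - expectation Y)"
  have X: "integrable M X" "integrable M (\<lambda>x. (X x)\<^sup>2)" "expectation X = 0"
    using Y by (auto simp: X_def prob_space)
  have dev: "(1 / real T) * (\<Sum>i<T. Y (w i)) - expectation Y = (\<Sum>i<T. X (w i)) / real T" for w
    using T by (simp add: X_def sum_subtractf field_simps)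
  have "\<delta> \<le> \<bar>(1 / real T) * (\<Sum>i<T. Y (w i)) - expectation Y\<bar> \<longleftrightarrow> (real T * \<delta>)\<^sup>2 \<le> (\<Sum>i<T. X (w i))\<^sup>2" for w
  proof -
    have "\<delta> \<le> \<bar>(\<Sum>i<T. X (w i)) / real T\<bar> \<longleftrightarrow> \<bar>real T * \<delta>\<bar> \<le> \<bar>\<Sum>i<T. X (w i)\<bar>"
      using T \<delta> by (simp add: abs_mult field_simps)
    then show ?thesis unfolding dev by (simp add: abs_le_square_iff)
  qed
  then have "measure ?P {w \<in> space ?P. \<delta> \<le> \<bar>(1 / real T) * (\<Sum>i<T. Y (w i)) - expectation Y\<bar>}
      = measure ?P {w \<in> space ?P. (real T * \<delta>)\<^sup>2 \<le> (\<Sum>i<T. X (w i))\<^sup>2}" by simp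
  also have "\<dots> \<le> (\<integral>w. (\<Sum>i<T. X (w i))\<^sup>2 \<partial>?P) / (real T * \<delta>)\<^sup>2"
    using T \<delta> by (intro integral_Markov_inequality_measure[where A="{}"] integral_PiM_square_sum(1) X) auto
  also have "\<dots> = expectation (\<lambda>x. (X x)\<^sup>2) / (real T * \<delta>\<^sup>2)"
    unfolding integral_PiM_square_sum(2)[OF X]
    using T by (simp add: power_mult_distrib power2_eq_square[of "real T"])
  finally show ?thesis by (simp add: X_def)
qed

subsection \<open>Mixtures\<close>

locale symm_mixture =
  fixes n :: nat and D :: "point measure"
  assumes n: "1 \<le> n" and D: "D \<in> Mix_P_symm n"

text \<open>The bounds for the components are affine in their means, so integrating over
  \<open>\<mu>\<close> turns them into the same bounds with the mean of \<open>D\<close>.\<close>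

lemma (in symm_mixture) mixture_properties:
  shows "prob_space D" and "sets D = sets (lebesgue_n n)"
    and "integrable D (sq_norm n)"
    and "integrable D (\<lambda>x. (sq_norm n x - real n)\<^sup>2)"
    and "(\<integral>x. (sq_norm n x - real n)\<^sup>2 \<partial>D) \<le> 64 * real n + real n * (real n - (\<integral>x. sq_norm n x \<partial>D))"
    and "\<And>A. A \<in> sets D \<Longrightarrow> \<bar>measure D A - measure (std_gaussian n) A\<bar> \<le> 40 * (real n - (\<integral>x. sq_norm n x \<partial>D))"
proof -
  obtain \<mu> where D_eq: "D = \<mu> \<bind> truncated_gaussian n" and "prob_space \<mu>"
    and sp: "space \<mu> \<subseteq> symm_convex_sets n"
    and meas: "truncated_gaussian n \<in> \<mu> \<rightarrow>\<^sub>M prob_algebra (lebesgue_n n)"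
    using D by (auto simp: Mix_P_symm_def)
  interpret \<mu>: prob_space \<mu> by fact
  note meas' = measurable_prob_algebraD[OF meas]
  have K: "symm_convex_set n K" if "K \<in> space \<mu>" for K
    using that sp by (auto simp: symm_convex_set_def)
  let ?m = "\<lambda>K. symm_convex_set.mean_sq n K"
  show sets_D: "sets D = sets (lebesgue_n n)"
    unfolding D_eq by (rule sets_bind) (auto simp: \<mu>.not_empty)
  show prob_D: "prob_space D"
    unfolding D_eq by (rule \<mu>.prob_space_bind[OF _ meas'])
      (auto intro!: AE_I2 symm_convex_set.prob_space_truncated_gaussian K)
  interpret D: prob_space D by fact
  have m_bounds: "0 \<le> ?m K" "?m K \<le> real n" if "K \<in> space \<mu>" for K
    using symm_convex_set.mean_sq_nonneg[OF K] symm_convex_set.mean_sq_le[OF K] that by auto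
  \<comment> \<open>The sigma-algebra on the sets \<open>K\<close> is arbitrary, so measurability
    can only come from the kernel: the mean is an integral against it.\<close>
  have m_meas: "?m \<in> borel_measurable \<mu>"
  proof -
    have "(\<lambda>K. enn2real (\<integral>\<^sup>+x. sq_norm n x \<partial>truncated_gaussian n K)) \<in> borel_measurable \<mu>"
      by (intro measurable_compose[OF measurable_compose[OF meas' nn_integral_measurable_subprob_algebra]
            borel_measurable_enn2real]) auto
    then show ?thesis
      by (rule measurable_cong[THEN iffD1, rotated])
        (simp add: symm_convex_set.nn_integral_sq_norm_truncated[OF K] m_bounds)
  qed
  have m_int: "integrable \<mu> ?m"
    using m_bounds m_meas by (intro \<mu>.integrable_const_bound[of _ "real n"]) auto
  define \<Delta> where "\<Delta> = \<mu>.expectation (\<lambda>K. real n - ?m K)"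
  have def_int: "integrable \<mu> (\<lambda>K. real n - ?m K)" using m_int by simp
  have nnY: "(\<integral>\<^sup>+x. sq_norm n x \<partial>D) = ennreal (\<mu>.expectation ?m)"
  proof -
    have "(\<integral>\<^sup>+x. sq_norm n x \<partial>D) = (\<integral>\<^sup>+K. \<integral>\<^sup>+x. sq_norm n x \<partial>truncated_gaussian n K \<partial>\<mu>)"
      unfolding D_eq by (rule nn_integral_bind[OF _ meas']) measurable
    also have "\<dots> = (\<integral>\<^sup>+K. ?m K \<partial>\<mu>)"
      by (intro nn_integral_cong) (simp add: symm_convex_set.nn_integral_sq_norm_truncated[OF K])
    also have "\<dots> = ennreal (\<mu>.expectation ?m)"
      using m_bounds by (intro nn_integral_eq_integral[OF m_int] AE_I2) auto
    finally show ?thesis .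
  qed
  have Y_meas[measurable]: "sq_norm n \<in> borel_measurable D"
    by (simp add: measurable_cong_sets[OF sets_D refl] measurable_sq_norm)
  show int_Y: "integrable D (sq_norm n)"
    by (rule integrableI_nonneg) (auto simp: nnY)
  have "0 \<le> \<mu>.expectation ?m" using m_bounds by (intro integral_nonneg_AE AE_I2) auto
  then have EY: "D.expectation (sq_norm n) = \<mu>.expectation ?m"
    using nn_integral_eq_integral[OF int_Y] nnY by simp
  have \<Delta>: "real n - D.expectation (sq_norm n) = \<Delta>"
    unfolding \<Delta>_def EY using m_int by (simp add: \<mu>.prob_space)
  have \<Delta>0: "0 \<le> \<Delta>" unfolding \<Delta>_def using m_bounds by (intro integral_nonneg_AE AE_I2) auto
  have "(\<integral>\<^sup>+x. ennreal ((sq_norm n x - real n)\<^sup>2) \<partial>D)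
      = (\<integral>\<^sup>+K. \<integral>\<^sup>+x. ennreal ((sq_norm n x - real n)\<^sup>2) \<partial>truncated_gaussian n K \<partial>\<mu>)"
    unfolding D_eq by (rule nn_integral_bind[OF _ meas']) measurable
  also have "\<dots> \<le> (\<integral>\<^sup>+K. ennreal (64 * real n + real n * (real n - ?m K)) \<partial>\<mu>)"
    by (intro nn_integral_mono symm_convex_set.second_moment_about_dimension K n)
  also have "\<dots> = ennreal (\<mu>.expectation (\<lambda>K. 64 * real n + real n * (real n - ?m K)))"
    using def_int m_bounds by (intro nn_integral_eq_integral AE_I2) auto
  also have "\<mu>.expectation (\<lambda>K. 64 * real n + real n * (real n - ?m K)) = 64 * real n + real n * \<Delta>"
    unfolding \<Delta>_def by (subst Bochner_Integration.integral_add) (use def_int in \<open>auto simp: \<mu>.prob_space\<close>)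
  finally have nnZ: "(\<integral>\<^sup>+x. ennreal ((sq_norm n x - real n)\<^sup>2) \<partial>D) \<le> ennreal (64 * real n + real n * \<Delta>)" .
  show int_Z: "integrable D (\<lambda>x. (sq_norm n x - real n)\<^sup>2)"
    by (rule integrableI_nonneg) (use nnZ in \<open>auto intro: le_less_trans\<close>)
  show "(\<integral>x. (sq_norm n x - real n)\<^sup>2 \<partial>D) \<le> 64 * real n + real n * (real n - (\<integral>x. sq_norm n x \<partial>D))"
  proof -
    have "(\<integral>\<^sup>+x. ennreal ((sq_norm n x - real n)\<^sup>2) \<partial>D) = ennreal (\<integral>x. (sq_norm n x - real n)\<^sup>2 \<partial>D)"
      by (rule nn_integral_eq_integral[OF int_Z]) simp
    with nnZ show ?thesis
      using \<Delta>0 unfolding \<Delta> by (simp only: ennreal_le_iff add_nonneg_nonneg mult_nonneg_nonneg of_nat_0_le_iff zero_le_numeral)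
  qed
  fix A assume "A \<in> sets D"
  then have A: "A \<in> sets (lebesgue_n n)" by (simp add: sets_D)
  have A_meas: "(\<lambda>K. measure (truncated_gaussian n K) A) \<in> borel_measurable \<mu>"
    using measurable_compose[OF meas' measurable_measure_subprob_algebra[OF A]] .
  have A_int: "integrable \<mu> (\<lambda>K. measure (truncated_gaussian n K) A)"
    using A_meas by (intro \<mu>.integrable_const_bound[of _ 1])
      (auto intro!: AE_I2 prob_space.prob_le_1 symm_convex_set.prob_space_truncated_gaussian K)
  have "measure D A = \<mu>.expectation (\<lambda>K. measure (truncated_gaussian n K) A)"
    unfolding D_eq by (rule \<mu>.measure_bind[OF meas' A])
  then have "\<bar>measure D A - measure (std_gaussian n) A\<bar>
      = \<bar>\<mu>.expectation (\<lambda>K. measure (truncated_gaussian n K) A - measure (std_gaussian n) A)\<bar>"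
    using A_int by (simp add: \<mu>.prob_space)
  also have "\<dots> \<le> \<mu>.expectation (\<lambda>K. \<bar>measure (truncated_gaussian n K) A - measure (std_gaussian n) A\<bar>)"
    by (rule integral_abs_bound)
  also have "\<dots> \<le> \<mu>.expectation (\<lambda>K. 40 * (real n - ?m K))"
  proof (rule integral_mono)
    fix K assume "K \<in> space \<mu>"
    note S = K[OF this]
    show "\<bar>measure (truncated_gaussian n K) A - measure (std_gaussian n) A\<bar> \<le> 40 * (real n - ?m K)"
      by (rule order.trans[OF symm_convex_set.truncated_gaussian_close[OF S A]])
        (use symm_convex_set.mean_sq_deficit[OF S] in simp)
  qed (use A_int m_int in auto)
  also have "\<dots> = 40 * (real n - (\<integral>x. sq_norm n x \<partial>D))"
    unfolding \<Delta> \<Delta>_def by (rule integral_mult_right_zero)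
  finally show "\<bar>measure D A - measure (std_gaussian n) A\<bar> \<le> 40 * (real n - (\<integral>x. sq_norm n x \<partial>D))" .
qed

lemma tv_dist_mixture:
  assumes "1 \<le> n" "D \<in> Mix_P_symm n"
  shows "tv_dist D (std_gaussian n) \<le> 40 * (real n - (\<integral>x. sq_norm n x \<partial>D))"
    and "tv_dist D (std_gaussian n) \<le> 1"
proof -
  interpret symm_mixture n D using assms by unfold_locales
  interpret D: prob_space D by (rule mixture_properties)
  show "tv_dist D (std_gaussian n) \<le> 40 * (real n - (\<integral>x. sq_norm n x \<partial>D))"
    unfolding tv_dist_def by (intro cSUP_least mixture_properties) auto
  show "tv_dist D (std_gaussian n) \<le> 1"
    unfolding tv_dist_def
  proof (intro cSUP_least)
    fix A
    show "\<bar>measure D A - measure (std_gaussian n) A\<bar> \<le> 1"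
      using D.prob_le_1[of A] std_gaussian.prob_le_1[of n A] measure_nonneg[of D A]
        measure_nonneg[of "std_gaussian n" A] by linarith
  qed auto
qed

section \<open>Error probabilities of the test\<close>

lemma sample_size_bounds:
  assumes "1 \<le> n" "0 < C" "0 < \<epsilon>"
  shows "C * real n / \<epsilon>\<^sup>2 \<le> real (sample_size C n \<epsilon>)" "0 < sample_size C n \<epsilon>"
proof -
  show le: "C * real n / \<epsilon>\<^sup>2 \<le> real (sample_size C n \<epsilon>)"
    unfolding sample_size_def by (rule real_nat_ceiling_ge)
  have "0 < C * real n / \<epsilon>\<^sup>2" using assms by simp
  also note le
  finally show "0 < sample_size C n \<epsilon>" by simp
qed

context symm_mixture
begin

lemma verdict_prob_complement:
  "verdict_prob c C n \<epsilon> D Untruncated + verdict_prob c C n \<epsilon> D Truncated = 1"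
proof -
  let ?T = "sample_size C n \<epsilon>"
  let ?P = "Pi\<^sub>M {..<?T} (\<lambda>_. D)"
  interpret D: prob_space D by (rule mixture_properties)
  interpret P: prob_space ?P by (intro prob_space_PiM) unfold_locales
  have [measurable]: "sq_norm n \<in> borel_measurable D"
    by (simp add: measurable_cong_sets[OF mixture_properties(2) refl] measurable_sq_norm)
  let ?U = "{x \<in> space ?P. test_verdict c C n \<epsilon> x = Untruncated}"
  have "?U = {x \<in> space ?P. real n - c * \<epsilon> / 2 \<le> (1 / real ?T) * (\<Sum>i<?T. sq_norm n (x i))}"
    by (auto simp: test_verdict_def mean_sq_norm_def norm_n_power2)
  also have "\<dots> \<in> sets ?P" by measurable
  finally have U: "?U \<in> sets ?P" .
  have "{x \<in> space ?P. test_verdict c C n \<epsilon> x = Truncated} = space ?P - ?U"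
    by (auto simp: test_verdict_def)
  then show ?thesis
    using P.prob_compl[OF U] by (simp add: verdict_prob_def)
qed

text \<open>The variance of the squared norm is at most its second moment about \<open>n\<close>,
  which \<open>mixture_properties\<close> bounds.\<close>

lemma Chebyshev_mean_sq_norm:
  assumes "0 < T" "0 < \<delta>"
  shows "measure (Pi\<^sub>M {..<T} (\<lambda>_. D))
      {w \<in> space (Pi\<^sub>M {..<T} (\<lambda>_. D)). \<delta> \<le> \<bar>mean_sq_norm n T w - (\<integral>x. sq_norm n x \<partial>D)\<bar>}
    \<le> (64 * real n + real n * (real n - (\<integral>x. sq_norm n x \<partial>D))) / (real T * \<delta>\<^sup>2)"
proof -
  interpret D: prob_space D by (rule mixture_properties)
  define m where "m = D.expectation (sq_norm n)"
  note int = mixture_properties(3,4)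
  have eq: "(sq_norm n x - m)\<^sup>2 = (sq_norm n x - real n)\<^sup>2 + (2 * (real n - m) * (sq_norm n x - real n) + (real n - m)\<^sup>2)" for x
    by (simp add: power2_eq_square algebra_simps)
  have int': "integrable D (\<lambda>x. 2 * (real n - m) * (sq_norm n x - real n) + (real n - m)\<^sup>2)"
    using int by simp
  have int_var: "integrable D (\<lambda>x. (sq_norm n x - m)\<^sup>2)"
    unfolding eq by (rule Bochner_Integration.integrable_add[OF int(2) int'])
  have "D.expectation (\<lambda>x. (sq_norm n x - m)\<^sup>2)
      = D.expectation (\<lambda>x. (sq_norm n x - real n)\<^sup>2) + (2 * (real n - m) * (m - real n) + (real n - m)\<^sup>2)"
    unfolding eq by (subst Bochner_Integration.integral_add[OF int(2) int'])
      (simp add: int m_def D.prob_space)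
  also have "\<dots> = D.expectation (\<lambda>x. (sq_norm n x - real n)\<^sup>2) - (real n - m)\<^sup>2"
    by (simp add: power2_eq_square algebra_simps)
  also have "\<dots> \<le> 64 * real n + real n * (real n - m)"
    using mixture_properties(5) by (simp add: m_def) (smt (verit) zero_le_power2)
  finally have var: "D.expectation (\<lambda>x. (sq_norm n x - m)\<^sup>2) \<le> 64 * real n + real n * (real n - m)" .
  have "measure (Pi\<^sub>M {..<T} (\<lambda>_. D))
      {w \<in> space (Pi\<^sub>M {..<T} (\<lambda>_. D)). \<delta> \<le> \<bar>mean_sq_norm n T w - m\<bar>}
    \<le> D.expectation (\<lambda>x. (sq_norm n x - m)\<^sup>2) / (real T * \<delta>\<^sup>2)"
    using D.Chebyshev_empirical_mean[OF int(1) int_var[unfolded m_def] assms]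
    unfolding mean_sq_norm_def norm_n_power2 m_def .
  also have "\<dots> \<le> (64 * real n + real n * (real n - m)) / (real T * \<delta>\<^sup>2)"
    using assms var by (intro divide_right_mono) auto
  finally show ?thesis by (simp add: m_def)
qed

lemma verdict_prob_le:
  assumes "0 < \<delta>" "0 < sample_size C n \<epsilon>"
    and "\<And>w. test_verdict c C n \<epsilon> w = v \<Longrightarrow>
      \<delta> \<le> \<bar>mean_sq_norm n (sample_size C n \<epsilon>) w - (\<integral>x. sq_norm n x \<partial>D)\<bar>"
  shows "verdict_prob c C n \<epsilon> D v
    \<le> (64 * real n + real n * (real n - (\<integral>x. sq_norm n x \<partial>D))) / (real (sample_size C n \<epsilon>) * \<delta>\<^sup>2)"
proof -
  let ?T = "sample_size C n \<epsilon>"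
  let ?P = "Pi\<^sub>M {..<?T} (\<lambda>_. D)"
  interpret D: prob_space D by (rule mixture_properties)
  interpret P: prob_space ?P by (intro prob_space_PiM) unfold_locales
  have [measurable]: "sq_norm n \<in> borel_measurable D"
    by (simp add: measurable_cong_sets[OF mixture_properties(2) refl] measurable_sq_norm)
  have "verdict_prob c C n \<epsilon> D v
      \<le> measure ?P {w \<in> space ?P. \<delta> \<le> \<bar>mean_sq_norm n ?T w - (\<integral>x. sq_norm n x \<partial>D)\<bar>}"
    unfolding verdict_prob_def
  proof (rule P.finite_measure_mono)
    show "{w \<in> space ?P. \<delta> \<le> \<bar>mean_sq_norm n ?T w - (\<integral>x. sq_norm n x \<partial>D)\<bar>} \<in> P.events"
      unfolding mean_sq_norm_def norm_n_power2 by measurable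
  qed (use assms in auto)
  also note Chebyshev_mean_sq_norm[OF assms(2,1)]
  finally show ?thesis .
qed

end

theorem theorem3p5:
  shows "\<exists>c C :: real. c > 0 \<and> C > 0 \<and>
    (\<forall>(n::nat) (\<epsilon>::real) D. n \<ge> 1 \<longrightarrow> \<epsilon> > 0 \<longrightarrow> D \<in> Mix_P_symm n \<longrightarrow>
      (D = std_gaussian n \<longrightarrow> verdict_prob c C n \<epsilon> D Untruncated \<ge> 9 / 10) \<and>
      (tv_dist D (std_gaussian n) \<ge> \<epsilon> \<longrightarrow> verdict_prob c C n \<epsilon> D Truncated \<ge> 9 / 10))"
proof (rule exI[of _ "1 / 40"], rule exI[of _ "10 ^ 7"], intro conjI allI impI)
  \<comment> \<open>The threshold constant \<open>1 / 40\<close> is the one of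
    \<open>mean_sq_deficit\<close>. Both error bounds below come out near
    \<open>4.1 * 10 ^ 5 / C\<close>, so \<open>10 ^ 7\<close> meets the required
    \<open>1 / 10\<close> with room to spare.\<close>
  fix n :: nat and \<epsilon> :: real and D
  let ?T = "sample_size (10 ^ 7) n \<epsilon>"
  assume n: "n \<ge> 1" and \<epsilon>: "\<epsilon> > 0" and D: "D \<in> Mix_P_symm n"
  interpret symm_mixture n D using n D by unfold_locales
  have T: "10 ^ 7 * real n / \<epsilon>\<^sup>2 \<le> real ?T" "0 < ?T"
    using sample_size_bounds[OF n _ \<epsilon>, of "10 ^ 7"] by auto
  define \<Delta> where "\<Delta> = real n - (\<integral>x. sq_norm n x \<partial>D)"
  have bound: "(64 * real n + real n * \<Delta>) / (real ?T * \<delta>\<^sup>2) \<le> (64 + \<Delta>) * \<epsilon>\<^sup>2 / (10 ^ 7 * \<delta>\<^sup>2)"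
    if "0 < \<delta>" "0 \<le> \<Delta>" for \<delta>
  proof -
    have "(64 * real n + real n * \<Delta>) / (real ?T * \<delta>\<^sup>2)
        \<le> (64 * real n + real n * \<Delta>) / (10 ^ 7 * real n / \<epsilon>\<^sup>2 * \<delta>\<^sup>2)"
      using T n \<epsilon> that by (intro divide_left_mono mult_right_mono mult_pos_pos) auto
    also have "\<dots> = (64 + \<Delta>) * \<epsilon>\<^sup>2 / (10 ^ 7 * \<delta>\<^sup>2)"
      using n \<epsilon> that by (simp add: divide_simps) (simp add: algebra_simps)
    finally show ?thesis .
  qed
  {
    assume "D = std_gaussian n"
    then have m: "(\<integral>x. sq_norm n x \<partial>D) = real n" by (simp add: integral_sq_norm)
    then have \<Delta>: "\<Delta> = 0" by (simp add: \<Delta>_def)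
    define \<delta> where "\<delta> = \<epsilon> / 80"
    have \<delta>: "0 < \<delta>" using \<epsilon> by (simp add: \<delta>_def)
    have "verdict_prob (1 / 40) (10 ^ 7) n \<epsilon> D Truncated \<le> (64 * real n + real n * \<Delta>) / (real ?T * \<delta>\<^sup>2)"
      unfolding \<Delta>_def
    proof (rule verdict_prob_le[OF \<delta> T(2)])
      fix w assume "test_verdict (1 / 40) (10 ^ 7) n \<epsilon> w = Truncated"
      then have "mean_sq_norm n ?T w < real n - \<epsilon> / 80"
        by (simp add: test_verdict_def split: if_splits)
      then show "\<delta> \<le> \<bar>mean_sq_norm n ?T w - (\<integral>x. sq_norm n x \<partial>D)\<bar>"
        unfolding m \<delta>_def by linarith
    qed
    also have "\<dots> \<le> (64 + \<Delta>) * \<epsilon>\<^sup>2 / (10 ^ 7 * \<delta>\<^sup>2)" using \<delta> by (intro bound) (auto simp: \<Delta>)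
    also have "\<dots> \<le> 1 / 10" using \<epsilon> by (simp add: \<Delta> \<delta>_def power_divide)
    finally show "9 / 10 \<le> verdict_prob (1 / 40) (10 ^ 7) n \<epsilon> D Untruncated"
      using verdict_prob_complement[of "1 / 40" "10 ^ 7" \<epsilon>] by simp
  next
    assume tv: "\<epsilon> \<le> tv_dist D (std_gaussian n)"
    have \<epsilon>\<Delta>: "\<epsilon> \<le> 40 * \<Delta>" and \<epsilon>1: "\<epsilon> \<le> 1"
      using tv_dist_mixture[OF n D] tv by (auto simp: \<Delta>_def)
    then have \<Delta>: "0 < \<Delta>" using \<epsilon> by linarith
    have "verdict_prob (1 / 40) (10 ^ 7) n \<epsilon> D Untruncated \<le> (64 * real n + real n * \<Delta>) / (real ?T * (\<Delta> / 2)\<^sup>2)"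
      unfolding \<Delta>_def
    proof (rule verdict_prob_le[OF _ T(2)])
      \<comment> \<open>The mean of \<open>D\<close> is \<open>n - \<Delta>\<close>, while the
        threshold is \<open>n - \<epsilon> / 80 >= n - \<Delta> / 2\<close>. A wrong verdict thus
        needs an upward deviation of at least \<open>\<Delta> / 2\<close>.\<close>
      fix w assume "test_verdict (1 / 40) (10 ^ 7) n \<epsilon> w = Untruncated"
      then have "real n - \<epsilon> / 80 \<le> mean_sq_norm n ?T w"
        by (simp add: test_verdict_def split: if_splits)
      then show "(real n - (\<integral>x. sq_norm n x \<partial>D)) / 2 \<le> \<bar>mean_sq_norm n ?T w - (\<integral>x. sq_norm n x \<partial>D)\<bar>"
        by (intro order.trans[OF _ abs_ge_self]) (use \<epsilon>\<Delta> in \<open>simp add: \<Delta>_def field_simps\<close>)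
    qed (use \<Delta> in \<open>simp add: \<Delta>_def\<close>)
    also have "\<dots> \<le> (64 + \<Delta>) * \<epsilon>\<^sup>2 / (10 ^ 7 * (\<Delta> / 2)\<^sup>2)" using \<Delta> by (intro bound) auto
    \<comment> \<open>Regrouped around \<open>\<epsilon> / \<Delta> <= 40\<close>. The variance
      contributed by the spread of the component means becomes
      \<open>\<epsilon> * (\<epsilon> / \<Delta>)\<close>, harmless because a total variation
      distance is at most 1 and hence \<open>\<epsilon> <= 1\<close>.\<close>
    also have "\<dots> = 4 * (64 * (\<epsilon> / \<Delta>)\<^sup>2 + \<epsilon> * (\<epsilon> / \<Delta>)) / 10 ^ 7"
      using \<Delta> by (simp add: power2_eq_square field_simps)
    also have "\<dots> \<le> 4 * (64 * 40\<^sup>2 + 1 * 40) / 10 ^ 7"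
      using \<epsilon> \<epsilon>\<Delta> \<epsilon>1 \<Delta>
      by (intro divide_right_mono mult_left_mono add_mono mult_mono power_mono) (auto simp: field_simps)
    also have "\<dots> \<le> 1 / 10" by simp
    finally show "9 / 10 \<le> verdict_prob (1 / 40) (10 ^ 7) n \<epsilon> D Truncated"
      using verdict_prob_complement[of "1 / 40" "10 ^ 7" \<epsilon>] by simp
  }
qed auto

end
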